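(* Let $\mathcal{C}$ be an extension-closed pseudovariety of finite groups and let $G$ be a residually-$\mathcal{C}$ group. Then $G$ is $\mathcal{C}$-hereditarily conjugacy separable if and only if, for every $g \in G$, both of the following hold in the pro-$\mathcal{C}$ completion $\widehat{G}^{\mathcal{C}}$ of $G$: (1) $g^{\widehat{G}^{\mathcal{C}}} \cap G = g^G$; (2) $\overline{C_G(g)} = C_{\widehat{G}^{\mathcal{C}}}(g)$.
   Context: An extension-closed pseudovariety of finite groups is a (non-empty, isomorphism-closed) class of finite groups closed under subgroups, finite direct products, quotients and extensions. Let $\mathcal{N}_{\mathcal{C}}(G)=\{N\unlhd G \mid G/N\in\mathcal{C}\}$; the pro-$\mathcal{C}$ topology on $G$ has as base all cosets $gN$, $N\in\mathcal{N}_{\mathcal{C}}(G)$. $G$ is residually-$\mathcal{C}$ if $\{1\}$ is closed in it; $\mathcal{C}$-conjugacy separable if every conjugacy class is closed in it; $\mathcal{C}$-hereditarily conjugacy separable if $G$ and every subgroup open in the pro-$\mathcal{C}$ topology of $G$ are $\mathcal{C}$-conjugacy separable (each with respect to its own pro-$\mathcal{C}$ topology). $\widehat{G}^{\mathcal{C}}=\varprojlim_{N\in\mathcal{N}_{\mathcal{C}}(G)} G/N$, with the topology induced from the product of discrete finite groups; for residually-$\mathcal{C}$ $G$, $G$ is identified with its image under the canonical embedding into $\widehat{G}^{\mathcal{C}}$. $\overline{X}$ denotes closure in $\widehat{G}^{\mathcal{C}}$, and $g^{H}=\{hgh^{-1}\mid h\in H\}$. *)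

theory Defs
  imports "HOL-Analysis.Analysis" "HOL-Algebra.Product_Groups"
begin

text \<open>
  Every finite group is isomorphic to one whose carrier is a set of natural numbers, so an
  isomorphism-closed class of finite groups is represented by a set of groups of type
  \<^typ>\<open>nat monoid\<close>. A group over an arbitrary type belongs to the class if it is isomorphic
  to a member of that set.
\<close>

definition in_class :: "nat monoid set \<Rightarrow> ('a, 'b) monoid_scheme \<Rightarrow> bool" where
  "in_class \<C> H \<longleftrightarrow> group H \<and> (\<exists>K\<in>\<C>. H \<cong> K)"

definition extension_closed_pseudovariety :: "nat monoid set \<Rightarrow> bool" where
  "extension_closed_pseudovariety \<C> \<longleftrightarrow>
     \<C> \<noteq> {} \<and>
     (\<forall>H\<in>\<C>. group H \<and> finite (carrier H)) \<and>
     (\<forall>H\<in>\<C>. \<forall>K::nat monoid. group K \<and> H \<cong> K \<longrightarrow> K \<in> \<C>) \<and>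
     (\<forall>H\<in>\<C>. \<forall>S. subgroup S H \<longrightarrow> H\<lparr>carrier := S\<rparr> \<in> \<C>) \<and>
     (\<forall>(I::nat set) F. finite I \<and> (\<forall>i\<in>I. F i \<in> \<C>) \<longrightarrow> in_class \<C> (product_group I F)) \<and>
     (\<forall>H\<in>\<C>. \<forall>N. N \<lhd> H \<longrightarrow> in_class \<C> (H Mod N)) \<and>
     (\<forall>(E::nat monoid) N. N \<lhd> E \<and> E\<lparr>carrier := N\<rparr> \<in> \<C> \<and> in_class \<C> (E Mod N) \<longrightarrow> E \<in> \<C>)"

definition co_normals :: "nat monoid set \<Rightarrow> ('a, 'b) monoid_scheme \<Rightarrow> 'a set set" where
  "co_normals \<C> G = {N. N \<lhd> G \<and> in_class \<C> (G Mod N)}"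

text \<open>The lemma \<open>openin_pro_topology\<close> below shows that the cosets do form a base.\<close>

definition pro_topology :: "nat monoid set \<Rightarrow> ('a, 'b) monoid_scheme \<Rightarrow> 'a topology" where
  "pro_topology \<C> G =
     topology (arbitrary union_of
       (\<lambda>U. \<exists>g\<in>carrier G. \<exists>N\<in>co_normals \<C> G. U = g <#\<^bsub>G\<^esub> N))"

definition residually :: "nat monoid set \<Rightarrow> ('a, 'b) monoid_scheme \<Rightarrow> bool" where
  "residually \<C> G \<longleftrightarrow> closedin (pro_topology \<C> G) {\<one>\<^bsub>G\<^esub>}"

definition conjugates :: "('a, 'b) monoid_scheme \<Rightarrow> 'a \<Rightarrow> 'a set \<Rightarrow> 'a set" where
  "conjugates G g H = {h \<otimes>\<^bsub>G\<^esub> g \<otimes>\<^bsub>G\<^esub> inv\<^bsub>G\<^esub> h | h. h \<in> H}"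

definition centralizer :: "('a, 'b) monoid_scheme \<Rightarrow> 'a \<Rightarrow> 'a set" where
  "centralizer G g = {h \<in> carrier G. h \<otimes>\<^bsub>G\<^esub> g = g \<otimes>\<^bsub>G\<^esub> h}"

definition conjugacy_separable :: "nat monoid set \<Rightarrow> ('a, 'b) monoid_scheme \<Rightarrow> bool" where
  "conjugacy_separable \<C> G \<longleftrightarrow>
     (\<forall>g\<in>carrier G. closedin (pro_topology \<C> G) (conjugates G g (carrier G)))"

definition hereditarily_conjugacy_separable ::
    "nat monoid set \<Rightarrow> ('a, 'b) monoid_scheme \<Rightarrow> bool" where
  "hereditarily_conjugacy_separable \<C> G \<longleftrightarrow>
     conjugacy_separable \<C> G \<and>
     (\<forall>H. subgroup H G \<and> openin (pro_topology \<C> G) H \<longrightarrow>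
        conjugacy_separable \<C> (G\<lparr>carrier := H\<rparr>))"

text \<open>
  The inverse limit consists of the families compatible with the canonical maps
  \<open>G/N \<rightarrow> G/M\<close>, \<open>Ng \<mapsto> Mg\<close>, for \<open>N \<subseteq> M\<close>.
\<close>

definition pro_completion ::
    "nat monoid set \<Rightarrow> ('a, 'b) monoid_scheme \<Rightarrow> ('a set \<Rightarrow> 'a set) monoid" where
  "pro_completion \<C> G =
     (product_group (co_normals \<C> G) (\<lambda>N. G Mod N))
       \<lparr>carrier := {x \<in> carrier (product_group (co_normals \<C> G) (\<lambda>N. G Mod N)).
          \<forall>N\<in>co_normals \<C> G. \<forall>M\<in>co_normals \<C> G. N \<subseteq> M \<longrightarrow>
            (\<forall>g\<in>carrier G. x N = N #>\<^bsub>G\<^esub> g \<longrightarrow> x M = M #>\<^bsub>G\<^esub> g)}\<rparr>"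

definition pro_completion_topology ::
    "nat monoid set \<Rightarrow> ('a, 'b) monoid_scheme \<Rightarrow> ('a set \<Rightarrow> 'a set) topology" where
  "pro_completion_topology \<C> G =
     subtopology (product_topology (\<lambda>N. discrete_topology (carrier (G Mod N))) (co_normals \<C> G))
       (carrier (pro_completion \<C> G))"

definition pro_completion_emb ::
    "nat monoid set \<Rightarrow> ('a, 'b) monoid_scheme \<Rightarrow> 'a \<Rightarrow> ('a set \<Rightarrow> 'a set)" where
  "pro_completion_emb \<C> G g = (\<lambda>N\<in>co_normals \<C> G. N #>\<^bsub>G\<^esub> g)"

lemma in_class_iso:
  assumes "in_class \<C> K" "group H" "H \<cong> K"
  shows "in_class \<C> H"
  using assms unfolding in_class_def by (meson iso_trans)

lemma extension_closed_pseudovarietyD: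
  fixes I :: "nat set"
  assumes "extension_closed_pseudovariety \<C>"
  shows "H \<in> \<C> \<Longrightarrow> group H"
    and "H \<in> \<C> \<Longrightarrow> subgroup S H \<Longrightarrow> H\<lparr>carrier := S\<rparr> \<in> \<C>"
    and "finite I \<Longrightarrow> (\<And>i. i \<in> I \<Longrightarrow> F i \<in> \<C>) \<Longrightarrow> in_class \<C> (product_group I F)"
proof -
  have 1: "\<forall>H\<in>\<C>. group H \<and> finite (carrier H)"
    using assms unfolding extension_closed_pseudovariety_def by (elim conjE) assumption
  have 2: "\<forall>H\<in>\<C>. \<forall>S. subgroup S H \<longrightarrow> H\<lparr>carrier := S\<rparr> \<in> \<C>"
    using assms unfolding extension_closed_pseudovariety_def by (elim conjE) assumption
  have 3: "\<forall>(I::nat set) F. finite I \<and> (\<forall>i\<in>I. F i \<in> \<C>) \<longrightarrow> in_class \<C> (product_group I F)"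
    using assms unfolding extension_closed_pseudovariety_def by (elim conjE) assumption
  show "H \<in> \<C> \<Longrightarrow> group H" using 1 by simp
  show "H \<in> \<C> \<Longrightarrow> subgroup S H \<Longrightarrow> H\<lparr>carrier := S\<rparr> \<in> \<C>" using 2 by simp
  show "finite I \<Longrightarrow> (\<And>i. i \<in> I \<Longrightarrow> F i \<in> \<C>) \<Longrightarrow> in_class \<C> (product_group I F)"
    using 3 by simp
qed

lemma in_class_imp:
  assumes "extension_closed_pseudovariety \<C>" "in_class \<C> H"
  obtains K f where "K \<in> \<C>" "group K" "f \<in> iso H K"
proof -
  obtain K where K: "K \<in> \<C>" "H \<cong> K" using assms(2) by (auto simp: in_class_def)
  obtain f where "f \<in> iso H K" using K(2) by (auto simp: is_iso_def)
  then show ?thesis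
    using that[OF K(1) extension_closed_pseudovarietyD(1)[OF assms(1) K(1)]] by simp
qed

lemma in_class_subgroup:
  assumes C: "extension_closed_pseudovariety \<C>" and H: "in_class \<C> H" and S: "subgroup S H"
  shows "in_class \<C> (H\<lparr>carrier := S\<rparr>)"
proof -
  obtain K f where K: "K \<in> \<C>" "group K" "f \<in> iso H K"
    using in_class_imp[OF C H] .
  have gH: "group H" using H by (simp add: in_class_def)
  interpret group_hom H K f
    using K gH by (simp add: group_hom_def group_hom_axioms_def iso_def)
  have sub: "subgroup (f ` S) K" by (rule subgroup_img_is_subgroup[OF S])
  have "f \<in> iso (H\<lparr>carrier := S\<rparr>) (K\<lparr>carrier := f ` S\<rparr>)"
    using K(3) subgroup.subset[OF S] subsetD[OF subgroup.subset[OF S]]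
    by (auto simp: iso_def bij_betw_def intro: inj_on_subset homI)
  moreover have "K\<lparr>carrier := f ` S\<rparr> \<in> \<C>"
    by (rule extension_closed_pseudovarietyD(2)[OF C K(1) sub])
  moreover have "group (H\<lparr>carrier := S\<rparr>)"
    using group.subgroup_imp_group[OF gH S] .
  ultimately show ?thesis
    unfolding in_class_def is_iso_def by blast
qed

lemma in_class_inj_hom:
  assumes C: "extension_closed_pseudovariety \<C>" and K: "in_class \<C> K" and H: "group H"
    and f: "f \<in> hom H K" "inj_on f (carrier H)"
  shows "in_class \<C> H"
proof -
  have gK: "group K" using K by (simp add: in_class_def)
  interpret group_hom H K f
    using H gK f by (simp add: group_hom_def group_hom_axioms_def)
  have "subgroup (f ` carrier H) K"
    by (rule img_is_subgroup)
  then have "in_class \<C> (K\<lparr>carrier := f ` carrier H\<rparr>)"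
    by (rule in_class_subgroup[OF C K])
  moreover have "f \<in> iso H (K\<lparr>carrier := f ` carrier H\<rparr>)"
    using f by (auto simp: iso_def hom_def bij_betw_def)
  ultimately show ?thesis
    using H in_class_iso is_iso_def by blast
qed

lemma co_normals_Int:
  assumes C: "extension_closed_pseudovariety \<C>" and G: "group G"
    and N: "N \<in> co_normals \<C> G" and M: "M \<in> co_normals \<C> G"
  shows "N \<inter> M \<in> co_normals \<C> G"
proof -
  interpret group G by fact
  have nN: "N \<lhd> G" and nM: "M \<lhd> G" and cN: "in_class \<C> (G Mod N)" and cM: "in_class \<C> (G Mod M)"
    using N M by (auto simp: co_normals_def)
  have nNM: "N \<inter> M \<lhd> G" using normal_subgroup_intersect[OF nN nM] .
  obtain K1 f1 where 1: "K1 \<in> \<C>" "group K1" "f1 \<in> iso (G Mod N) K1"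
    using in_class_imp[OF C cN] .
  obtain K2 f2 where 2: "K2 \<in> \<C>" "group K2" "f2 \<in> iso (G Mod M) K2"
    using in_class_imp[OF C cM] .
  define F where "F = (\<lambda>i::nat. if i = 0 then K1 else K2)"
  define P where "P = product_group {0, 1} F"
  have P: "in_class \<C> P"
    unfolding P_def by (rule extension_closed_pseudovarietyD(3)[OF C]) (use 1 2 in \<open>auto simp: F_def\<close>)
  have gP: "group P" using P by (simp add: in_class_def)
  define h1 where "h1 = (\<lambda>g. f1 (N #>\<^bsub>G\<^esub> g))"
  define h2 where "h2 = (\<lambda>g. f2 (M #>\<^bsub>G\<^esub> g))"
  have h1: "h1 \<in> hom G K1"
    using normal.r_coset_hom_Mod[OF nN] 1(3) by (auto simp: iso_def hom_def h1_def Pi_iff)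
  have h2: "h2 \<in> hom G K2"
    using normal.r_coset_hom_Mod[OF nM] 2(3) by (auto simp: iso_def hom_def h2_def Pi_iff)
  define h where "h = (\<lambda>g. \<lambda>i\<in>{0, 1::nat}. if i = 0 then h1 g else h2 g)"
  have h: "h \<in> hom G P"
    using h1 h2 by (auto simp: hom_def P_def F_def h_def fun_eq_iff Pi_iff PiE_iff)
  interpret h: group_hom G P h
    using h gP by (simp add: group_hom_def group_hom_axioms_def)
  have coset: "(A #>\<^bsub>G\<^esub> g = A) \<longleftrightarrow> g \<in> A" if "A \<lhd> G" "g \<in> carrier G" for A g
    using that by (metis coset_join1 coset_join2 normal_imp_subgroup subgroup.subset)
  have k1: "h1 g = \<one>\<^bsub>K1\<^esub> \<longleftrightarrow> g \<in> N" if "g \<in> carrier G" for g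
  proof -
    interpret f1: group_hom "G Mod N" K1 f1
      using 1 cN by (simp add: group_hom_def group_hom_axioms_def iso_def in_class_def)
    have inj: "inj_on f1 (carrier (G Mod N))" using 1(3) by (simp add: iso_def bij_betw_def)
    have "N #>\<^bsub>G\<^esub> g \<in> carrier (G Mod N)" using that by (simp add: carrier_FactGroup)
    then have "f1 (N #>\<^bsub>G\<^esub> g) = \<one>\<^bsub>K1\<^esub> \<longleftrightarrow> N #>\<^bsub>G\<^esub> g = N"
      using inj f1.hom_one f1.G.one_closed by (metis inj_onD one_FactGroup)
    then show ?thesis using coset[OF nN that] by (simp add: h1_def)
  qed
  have k2: "h2 g = \<one>\<^bsub>K2\<^esub> \<longleftrightarrow> g \<in> M" if "g \<in> carrier G" for g
  proof -
    interpret f2: group_hom "G Mod M" K2 f2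
      using 2 cM by (simp add: group_hom_def group_hom_axioms_def iso_def in_class_def)
    have inj: "inj_on f2 (carrier (G Mod M))" using 2(3) by (simp add: iso_def bij_betw_def)
    have "M #>\<^bsub>G\<^esub> g \<in> carrier (G Mod M)" using that by (simp add: carrier_FactGroup)
    then have "f2 (M #>\<^bsub>G\<^esub> g) = \<one>\<^bsub>K2\<^esub> \<longleftrightarrow> M #>\<^bsub>G\<^esub> g = M"
      using inj f2.hom_one f2.G.one_closed by (metis inj_onD one_FactGroup)
    then show ?thesis using coset[OF nM that] by (simp add: h2_def)
  qed
  have ker: "kernel G P h = N \<inter> M"
    using k1 k2 subgroup.subset[OF normal_imp_subgroup[OF nN]]
    by (auto simp: kernel_def P_def F_def h_def fun_eq_iff split: if_splits)
  have hm: "(\<lambda>X. the_elem (h ` X)) \<in> hom (G Mod kernel G P h) P"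
    by (rule h.FactGroup_hom)
  have inj: "inj_on (\<lambda>X. the_elem (h ` X)) (carrier (G Mod kernel G P h))"
    by (rule h.FactGroup_inj_on)
  have "in_class \<C> (G Mod (N \<inter> M))"
    using in_class_inj_hom[OF C P _ hm inj] ker normal.factorgroup_is_group[OF nNM] by simp
  with nNM show ?thesis by (simp add: co_normals_def)
qed

lemma openin_pro_topology:
  assumes C: "extension_closed_pseudovariety \<C>" and G: "group G"
  shows "openin (pro_topology \<C> G) =
    arbitrary union_of (\<lambda>U. \<exists>g\<in>carrier G. \<exists>N\<in>co_normals \<C> G. U = g <#\<^bsub>G\<^esub> N)"
proof -
  interpret group G by fact
  let ?B = "\<lambda>U. \<exists>g\<in>carrier G. \<exists>N\<in>co_normals \<C> G. U = g <#\<^bsub>G\<^esub> N"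
  have rep: "g <#\<^bsub>G\<^esub> N = x <#\<^bsub>G\<^esub> N" if "N \<in> co_normals \<C> G" "g \<in> carrier G" "x \<in> g <#\<^bsub>G\<^esub> N" for g x N
    using l_repr_independence that normal_imp_subgroup by (metis (no_types, lifting) co_normals_def mem_Collect_eq)
  have "(arbitrary union_of ?B) (S \<inter> T)" if S: "?B S" and T: "?B T" for S T
  proof (subst arbitrary_union_of_alt, intro ballI)
    fix x assume x: "x \<in> S \<inter> T"
    obtain g N where N: "g \<in> carrier G" "N \<in> co_normals \<C> G" "S = g <#\<^bsub>G\<^esub> N" using S by blast
    obtain k M where M: "k \<in> carrier G" "M \<in> co_normals \<C> G" "T = k <#\<^bsub>G\<^esub> M" using T by blast
    have sub: "subgroup N G" "subgroup M G"
      using N M normal_imp_subgroup by (auto simp: co_normals_def)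
    have xc: "x \<in> carrier G"
      using x N sub l_coset_subset_G subgroup.subset by blast
    have eq: "S = x <#\<^bsub>G\<^esub> N" "T = x <#\<^bsub>G\<^esub> M" using rep[OF N(2,1)] rep[OF M(2,1)] N(3) M(3) x by blast+
    have 1: "?B (x <#\<^bsub>G\<^esub> (N \<inter> M))" using co_normals_Int[OF C G N(2) M(2)] xc by blast
    have 2: "x \<in> x <#\<^bsub>G\<^esub> (N \<inter> M)"
      unfolding l_coset_def
      by (rule UN_I[of "\<one>\<^bsub>G\<^esub>"]) (use xc subgroup.one_closed[OF sub(1)] subgroup.one_closed[OF sub(2)] in simp_all)
    have 3: "x <#\<^bsub>G\<^esub> (N \<inter> M) \<subseteq> S \<inter> T" unfolding eq by (auto simp: l_coset_def)
    show "\<exists>U. ?B U \<and> x \<in> U \<and> U \<subseteq> S \<inter> T"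
      by (intro exI[of _ "x <#\<^bsub>G\<^esub> (N \<inter> M)"] conjI 1 2 3)
  qed
  then have "istopology (arbitrary union_of ?B)"
    unfolding istopology_base_eq by blast
  then show ?thesis
    unfolding pro_topology_def by (rule topology_inverse')
qed

end

theory Submission
  imports Defs "HOL-Algebra.Weak_Morphisms" "HOL-Algebra.Zassenhaus"
begin

text \<open>
  Hereditary conjugacy separability is equivalent to conjugacy separability together with the
  centralizer condition: for every \<open>g\<close> and every co-\<open>\<C>\<close> normal subgroup \<open>K\<close> there is a co-\<open>\<C>\<close>
  normal subgroup \<open>L \<subseteq> K\<close> such that whatever centralizes \<open>g\<close> modulo \<open>L\<close> lies in \<open>C\<^sub>G(g) K\<close>.
  By compactness of the completion, conjugacy separability is statement (1) and the centralizer
  condition is statement (2): a thread of conjugating (resp. centralizing) elements in the finite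
  quotients \<open>G/N\<close> is an element of the completion.
\<close>

subsection \<open>Co-\<open>\<C>\<close> normal subgroups\<close>

text \<open>An open subgroup H carries two topologies, its own pro-\<C> topology and the one induced
  from G, and hereditary separability speaks of the first. Intersecting a co-\<C> subgroup of G with
  H costs only closure under subgroups. Passing back, from a co-\<C> subgroup of H to a smaller one
  of G, is the harder direction, and it is what lets a separation found inside H be read in a
  quotient of G. The centralizer condition does not mention the completion. Hence the
  group-theoretic equivalence and the compactness argument are independent of each other, and they
  meet in coset equations between elements of G. The assumption that G is residually-\<C> enters
  through the injectivity of the embedding, by which membership in a conjugacy class of G can be
  tested on images in the completion.\<close>

lemma in_class_finite:
  assumes C: "extension_closed_pseudovariety \<C>" and H: "in_class \<C> H"
  shows "finite (carrier H)"
proof -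
  obtain K f where K: "K \<in> \<C>" and f: "f \<in> iso H K"
    using in_class_imp[OF C H] .
  have "\<forall>H\<in>\<C>. group H \<and> finite (carrier H)"
    using C unfolding extension_closed_pseudovariety_def by (elim conjE) assumption
  with K f show ?thesis
    using bij_betw_finite by (auto simp: iso_def)
qed

lemma in_class_nat_iff:
  fixes K :: "nat monoid"
  assumes C: "extension_closed_pseudovariety \<C>"
  shows "in_class \<C> K \<longleftrightarrow> K \<in> \<C>"
proof
  assume K: "in_class \<C> K"
  then obtain H where H: "H \<in> \<C>" "K \<cong> H" "group K" by (auto simp: in_class_def)
  then have "H \<cong> K" using group.iso_sym by blast
  moreover have "\<forall>H\<in>\<C>. \<forall>K::nat monoid. group K \<and> H \<cong> K \<longrightarrow> K \<in> \<C>"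
    using C unfolding extension_closed_pseudovariety_def by (elim conjE) assumption
  ultimately show "K \<in> \<C>" using H by blast
next
  assume "K \<in> \<C>"
  then show "in_class \<C> K"
    using extension_closed_pseudovarietyD(1)[OF C] by (auto simp: in_class_def intro: iso_refl)
qed

text \<open>The quotient by the kernel embeds in B, so closure under subgroups suffices and f may
  fail to be surjective.\<close>

lemma kernel_in_co_normals:
  assumes C: "extension_closed_pseudovariety \<C>" and A: "group A" and B: "in_class \<C> B"
    and f: "f \<in> hom A B"
  shows "kernel A B f \<in> co_normals \<C> A"
proof -
  interpret group_hom A B f
    using assms by (simp add: group_hom_def group_hom_axioms_def in_class_def)
  show ?thesis
    unfolding co_normals_def
    using normal_kernel in_class_inj_hom[OF C B _ FactGroup_hom FactGroup_inj_on]
      normal.factorgroup_is_group by blast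
qed

text \<open>The preimage is the kernel of the composite of f with the projection from B to B/N. Used
  for inclusions of subgroups and for conjugation maps.\<close>

lemma vimage_in_co_normals:
  assumes C: "extension_closed_pseudovariety \<C>" and A: "group A" and B: "group B"
    and f: "f \<in> hom A B" and N: "N \<in> co_normals \<C> B"
  shows "{a \<in> carrier A. f a \<in> N} \<in> co_normals \<C> A"
proof -
  have n: "N \<lhd> B" and c: "in_class \<C> (B Mod N)" using N by (auto simp: co_normals_def)
  have sub: "subgroup N B" using n by (rule normal_imp_subgroup)
  have h: "(\<lambda>a. N #>\<^bsub>B\<^esub> f a) \<in> hom A (B Mod N)"
    using hom_compose[OF f normal.r_coset_hom_Mod[OF n]] by (simp add: comp_def)
  have "N #>\<^bsub>B\<^esub> f a = N \<longleftrightarrow> f a \<in> N" if "a \<in> carrier A" for a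
  proof -
    have "f a \<in> carrier B" using f that by (auto simp: hom_def)
    then show ?thesis using group.coset_join1[OF B _ _ sub] group.coset_join2[OF B _ sub] by blast
  qed
  then have "kernel A (B Mod N) (\<lambda>a. N #>\<^bsub>B\<^esub> f a) = {a \<in> carrier A. f a \<in> N}"
    by (auto simp: kernel_def)
  with kernel_in_co_normals[OF C A c h] show ?thesis by simp
qed

text \<open>Closure under extensions is postulated only for groups carried by natural numbers. Here
  Q is finite, being a union of finitely many cosets of a finite kernel, so it has a copy over
  \<open>nat\<close> to which the axiom applies.\<close>

lemma in_class_extension:
  assumes C: "extension_closed_pseudovariety \<C>" and Q: "group Q" and B: "in_class \<C> B"
    and f: "f \<in> hom Q B" and k: "in_class \<C> (Q\<lparr>carrier := kernel Q B f\<rparr>)"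
  shows "in_class \<C> Q"
proof -
  interpret f: group_hom Q B f
    using assms by (simp add: group_hom_def group_hom_axioms_def in_class_def)
  let ?N = "kernel Q B f"
  have sub: "subgroup ?N Q" by (rule f.subgroup_kernel)
  have "in_class \<C> (Q Mod ?N)"
    using kernel_in_co_normals[OF C Q B f] by (simp add: co_normals_def)
  then have "finite (rcosets\<^bsub>Q\<^esub> ?N)"
    using in_class_finite[OF C] by (fastforce simp: FactGroup_def)
  moreover have "finite X" if X: "X \<in> rcosets\<^bsub>Q\<^esub> ?N" for X
  proof -
    obtain x where "X = ?N #>\<^bsub>Q\<^esub> x" using X by (auto simp: RCOSETS_def)
    then show ?thesis
      using in_class_finite[OF C k] by (auto simp: r_coset_def)
  qed
  ultimately have "finite (carrier Q)"
    using f.G.rcosets_part_G[OF sub] by (metis finite_Union)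
  then obtain e :: "'a \<Rightarrow> nat" where e: "inj_on e (carrier Q)"
    using finite_imp_inj_to_nat_seg by blast
  \<comment> \<open>E is the copy of Q carried by the image of e, and d is the isomorphism back. The
    kernel of \<open>f \<circ> d\<close> then corresponds to the kernel of f.\<close>
  define E where "E = image_group e Q"
  have gE: "group E" unfolding E_def by (rule f.G.inj_imp_image_group_is_group[OF e])
  have ie: "e \<in> iso Q E" unfolding E_def by (rule inj_imp_image_group_iso[OF e])
  define d where "d = inv_into (carrier Q) e"
  have id: "d \<in> iso E Q" unfolding d_def by (rule f.G.iso_set_sym[OF ie])
  have fd: "f \<circ> d \<in> hom E B"
    using id f by (auto intro: hom_compose simp: iso_def)
  let ?M = "kernel E B (f \<circ> d)"
  have M: "?M \<in> co_normals \<C> E" by (rule kernel_in_co_normals[OF C gE B fd])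
  have sM: "subgroup ?M E" using M by (auto simp: co_normals_def normal_imp_subgroup)
  have "in_class \<C> (E\<lparr>carrier := ?M\<rparr>)"
  proof (rule in_class_inj_hom[OF C k])
    show "group (E\<lparr>carrier := ?M\<rparr>)" using group.subgroup_imp_group[OF gE sM] .
    show "d \<in> hom (E\<lparr>carrier := ?M\<rparr>) (Q\<lparr>carrier := ?N\<rparr>)"
      using id by (auto simp: iso_def hom_def kernel_def)
    show "inj_on d (carrier (E\<lparr>carrier := ?M\<rparr>))"
      using id by (auto simp: iso_def bij_betw_def kernel_def inj_on_def)
  qed
  then have "E\<lparr>carrier := ?M\<rparr> \<in> \<C>" by (simp add: in_class_nat_iff[OF C])
  moreover have "\<forall>(E::nat monoid) N.
      N \<lhd> E \<and> E\<lparr>carrier := N\<rparr> \<in> \<C> \<and> in_class \<C> (E Mod N) \<longrightarrow> E \<in> \<C>"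
    using C unfolding extension_closed_pseudovariety_def by (elim conjE) assumption
  ultimately have "E \<in> \<C>" using M by (auto simp: co_normals_def)
  then show ?thesis
    using ie Q by (auto simp: in_class_def is_iso_def)
qed

text \<open>G/L is an extension of G/K by K/L: the map q from G/L to G/K has K/L as its kernel. That
  L is normal in G, and not merely in K, is what makes G/L a group.\<close>

lemma co_normals_trans:
  assumes C: "extension_closed_pseudovariety \<C>" and G: "group G" and K: "K \<in> co_normals \<C> G"
    and L: "L \<lhd> G" "L \<subseteq> K" "L \<in> co_normals \<C> (G\<lparr>carrier := K\<rparr>)"
  shows "L \<in> co_normals \<C> G"
proof -
  interpret group G by fact
  have nK: "K \<lhd> G" and cK: "in_class \<C> (G Mod K)" using K by (auto simp: co_normals_def)
  have gK: "group (G Mod K)" using cK by (simp add: in_class_def)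
  have sK: "subgroup K G" using nK by (rule normal_imp_subgroup)
  have sL: "subgroup L G" using L(1) by (rule normal_imp_subgroup)
  have gL: "group (G Mod L)" by (rule normal.factorgroup_is_group[OF L(1)])
  interpret p: group_hom G "G Mod K" "\<lambda>a. K #>\<^bsub>G\<^esub> a"
    using normal.r_coset_hom_Mod[OF nK] gK
    by (simp add: group_hom_def group_hom_axioms_def)
  have "L \<subseteq> kernel G (G Mod K) (\<lambda>a. K #>\<^bsub>G\<^esub> a)"
    using L(2) coset_join2[OF _ sK] subgroup.subset[OF sK] by (auto simp: kernel_def)
  then obtain q where q: "q \<in> hom (G Mod L) (G Mod K)"
    "\<And>x. x \<in> carrier G \<Longrightarrow> q (L #>\<^bsub>G\<^esub> x) = K #>\<^bsub>G\<^esub> x"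
    using p.FactGroup_universal_kernel[OF L(1)] by blast
  let ?N = "kernel (G Mod L) (G Mod K) q"
  interpret q: group_hom "G Mod L" "G Mod K" q
    using q(1) gK gL by (simp add: group_hom_def group_hom_axioms_def)
  \<comment> \<open>A coset of L by an element of K is the same set whether formed in G or in K, so
    the identity map embeds the kernel of q in K/L.\<close>
  have N: "?N \<subseteq> carrier (G\<lparr>carrier := K\<rparr> Mod L)"
  proof
    fix X assume "X \<in> ?N"
    then obtain x where x: "x \<in> carrier G" "X = L #>\<^bsub>G\<^esub> x" and "q X = K"
      by (auto simp: kernel_def carrier_FactGroup)
    then have "x \<in> K" using q(2)[OF x(1)] coset_join1[OF _ x(1) sK] by simp
    then show "X \<in> carrier (G\<lparr>carrier := K\<rparr> Mod L)"
      using x(2) by (simp add: carrier_FactGroup r_coset_def)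
  qed
  have "in_class \<C> ((G Mod L)\<lparr>carrier := ?N\<rparr>)"
  proof (rule in_class_inj_hom[OF C])
    show "in_class \<C> (G\<lparr>carrier := K\<rparr> Mod L)" using L(3) by (simp add: co_normals_def)
    show "group ((G Mod L)\<lparr>carrier := ?N\<rparr>)"
      using group.subgroup_imp_group[OF gL q.subgroup_kernel] .
    show "(\<lambda>X. X) \<in> hom ((G Mod L)\<lparr>carrier := ?N\<rparr>) (G\<lparr>carrier := K\<rparr> Mod L)"
      using N by (auto simp: hom_def set_mult_def)
  qed simp
  then have "in_class \<C> (G Mod L)"
    by (rule in_class_extension[OF C gL cK q(1)])
  then show ?thesis using L(1) by (simp add: co_normals_def)
qed

text \<open>Such an f factors through the finite set G/K. This bounds the number of conjugates in
  the core of an open subgroup and the number of boxes in the compactness argument.\<close>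

lemma finite_image_cosets:
  assumes C: "extension_closed_pseudovariety \<C>" and G: "group G" and K: "K \<in> co_normals \<C> G"
    and f: "\<And>x y. x \<in> carrier G \<Longrightarrow> y \<in> carrier G \<Longrightarrow> K #>\<^bsub>G\<^esub> x = K #>\<^bsub>G\<^esub> y \<Longrightarrow> f x = f y"
  shows "finite (f ` carrier G)"
proof -
  let ?q = "inv_into (carrier G) (\<lambda>x. K #>\<^bsub>G\<^esub> x)"
  have "f x \<in> (\<lambda>X. f (?q X)) ` carrier (G Mod K)" if x: "x \<in> carrier G" for x
  proof -
    have X: "K #>\<^bsub>G\<^esub> x \<in> (\<lambda>x. K #>\<^bsub>G\<^esub> x) ` carrier G" using x by blast
    have "f x = f (?q (K #>\<^bsub>G\<^esub> x))"
      by (rule f[OF x inv_into_into[OF X]]) (rule f_inv_into_f[OF X, symmetric])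
    then show ?thesis using X by (auto simp: carrier_FactGroup)
  qed
  then have "f ` carrier G \<subseteq> (\<lambda>X. f (?q X)) ` carrier (G Mod K)" by blast
  then show ?thesis
    using K in_class_finite[OF C] by (auto simp: co_normals_def intro: finite_surj)
qed

lemma carrier_in_co_normals:
  assumes C: "extension_closed_pseudovariety \<C>" and G: "group G"
  shows "carrier G \<in> co_normals \<C> G"
proof -
  \<comment> \<open>The empty product is the trivial group, so closure under finite products
    supplies it. Since the index set is empty, the factor \<open>undefined\<close> is never
    evaluated.\<close>
  let ?T = "product_group ({}::nat set) (\<lambda>_. undefined :: nat monoid)"
  have T: "in_class \<C> ?T"
    by (rule extension_closed_pseudovarietyD(3)[OF C]) auto
  have "kernel G ?T (\<lambda>_. (\<lambda>x\<in>{}. undefined)) \<in> co_normals \<C> G"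
    by (rule kernel_in_co_normals[OF C G T]) (auto simp: hom_def)
  then show ?thesis by (simp add: kernel_def restrict_def)
qed

text \<open>The family has to be nonempty because \<open>\<Inter>{}\<close> is the whole type rather
  than the carrier of G. Where this is not automatic, an extra member is inserted into the
  family.\<close>

lemma co_normals_Inter:
  assumes C: "extension_closed_pseudovariety \<C>" and G: "group G"
    and "finite F" "F \<noteq> {}" "F \<subseteq> co_normals \<C> G"
  shows "\<Inter>F \<in> co_normals \<C> G"
  using assms(3-5) by (induction F rule: finite_ne_induct) (simp_all add: co_normals_Int[OF C G])

text \<open>
  The core in \<open>G\<close> of \<open>M \<inter> K\<close> is a finite intersection of conjugates since \<open>K\<close> normalizes \<open>M \<inter> K\<close>;
  its quotient in \<open>G\<close> is an extension, which is where closure under extensions enters.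
\<close>

lemma co_normals_of_open_subgroup:
  assumes C: "extension_closed_pseudovariety \<C>" and G: "group G"
    and H: "subgroup H G" and K: "K \<in> co_normals \<C> G" "K \<subseteq> H"
    and M: "M \<in> co_normals \<C> (G\<lparr>carrier := H\<rparr>)"
  obtains L where "L \<in> co_normals \<C> G" "L \<subseteq> M"
proof -
  interpret group G by fact
  let ?H = "G\<lparr>carrier := H\<rparr>" and ?K = "G\<lparr>carrier := K\<rparr>"
  have nK: "K \<lhd> G" and cK: "in_class \<C> (G Mod K)" using K by (auto simp: co_normals_def)
  have sK: "subgroup K G" using nK by (rule normal_imp_subgroup)
  have gK: "group ?K" and gH: "group ?H" using sK H subgroup_imp_group by auto
  have nM: "M \<lhd> ?H" using M by (simp add: co_normals_def)
  have Kc: "x \<in> carrier G" if "x \<in> K" for x using subgroup.mem_carrier[OF sK that] .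
  have conjK: "x \<otimes>\<^bsub>G\<^esub> a \<otimes>\<^bsub>G\<^esub> inv\<^bsub>G\<^esub> x \<in> K" if "x \<in> carrier G" "a \<in> K" for x a
    using normal.inv_op_closed2[OF nK that] .
  \<comment> \<open>\<open>A x\<close> is the intersection of K with x^-1 M x. Conjugation by x maps
    K to K, hence into H, so \<open>A x\<close> is the preimage of M under a homomorphism from K to
    H and is therefore co-\<C> in K.\<close>
  define A where "A = (\<lambda>x. {a \<in> K. x \<otimes>\<^bsub>G\<^esub> a \<otimes>\<^bsub>G\<^esub> inv\<^bsub>G\<^esub> x \<in> M})"
  have A: "A x \<in> co_normals \<C> ?K" if x: "x \<in> carrier G" for x
  proof -
    have "(\<lambda>a. x \<otimes>\<^bsub>G\<^esub> a \<otimes>\<^bsub>G\<^esub> inv\<^bsub>G\<^esub> x) \<in> hom ?K ?H"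
    proof (rule homI)
      fix a assume "a \<in> carrier ?K"
      then show "x \<otimes>\<^bsub>G\<^esub> a \<otimes>\<^bsub>G\<^esub> inv\<^bsub>G\<^esub> x \<in> carrier ?H" using conjK[OF x] K(2) by auto
    next
      fix a b assume "a \<in> carrier ?K" "b \<in> carrier ?K"
      then have "a \<in> carrier G" "b \<in> carrier G" using Kc by auto
      then show "x \<otimes>\<^bsub>G\<^esub> (a \<otimes>\<^bsub>?K\<^esub> b) \<otimes>\<^bsub>G\<^esub> inv\<^bsub>G\<^esub> x =
          (x \<otimes>\<^bsub>G\<^esub> a \<otimes>\<^bsub>G\<^esub> inv\<^bsub>G\<^esub> x) \<otimes>\<^bsub>?H\<^esub> (x \<otimes>\<^bsub>G\<^esub> b \<otimes>\<^bsub>G\<^esub> inv\<^bsub>G\<^esub> x)"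
        using x by (simp add: m_assoc inv_solve_left)
    qed
    from vimage_in_co_normals[OF C gK gH this M] show ?thesis by (simp add: A_def)
  qed
  \<comment> \<open>An element k of K lies in H and so normalizes M. One inclusion is enough:
    applied to two elements of the same coset in both directions, it gives equality.\<close>
  have A_sub: "A x \<subseteq> A (k \<otimes>\<^bsub>G\<^esub> x)" if k: "k \<in> K" and x: "x \<in> carrier G" for k x
  proof
    fix a assume a: "a \<in> A x"
    then have "a \<in> K" and m: "x \<otimes>\<^bsub>G\<^esub> a \<otimes>\<^bsub>G\<^esub> inv\<^bsub>G\<^esub> x \<in> M" by (auto simp: A_def)
    have kH: "k \<in> H" using k K(2) by blast
    have "k \<otimes>\<^bsub>G\<^esub> (x \<otimes>\<^bsub>G\<^esub> a \<otimes>\<^bsub>G\<^esub> inv\<^bsub>G\<^esub> x) \<otimes>\<^bsub>G\<^esub> inv\<^bsub>G\<^esub> k \<in> M"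
      using normal.inv_op_closed2[OF nM _ m, of k] kH H by simp
    moreover have "(k \<otimes>\<^bsub>G\<^esub> x) \<otimes>\<^bsub>G\<^esub> a \<otimes>\<^bsub>G\<^esub> inv\<^bsub>G\<^esub> (k \<otimes>\<^bsub>G\<^esub> x) =
        k \<otimes>\<^bsub>G\<^esub> (x \<otimes>\<^bsub>G\<^esub> a \<otimes>\<^bsub>G\<^esub> inv\<^bsub>G\<^esub> x) \<otimes>\<^bsub>G\<^esub> inv\<^bsub>G\<^esub> k"
      using x Kc[OF k] Kc[OF \<open>a \<in> K\<close>] by (simp add: m_assoc inv_mult_group)
    ultimately show "a \<in> A (k \<otimes>\<^bsub>G\<^esub> x)" using \<open>a \<in> K\<close> by (simp add: A_def)
  qed
  have A_coset: "A x = A y" if x: "x \<in> carrier G" and y: "y \<in> carrier G"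
    and xy: "K #>\<^bsub>G\<^esub> x = K #>\<^bsub>G\<^esub> y" for x y
  proof -
    obtain k where k: "k \<in> K" "y = k \<otimes>\<^bsub>G\<^esub> x"
      using repr_independenceD[OF sK y xy] by (auto simp: r_coset_def)
    obtain l where l: "l \<in> K" "x = l \<otimes>\<^bsub>G\<^esub> y"
      using repr_independenceD[OF sK x xy[symmetric]] by (auto simp: r_coset_def)
    have "A x \<subseteq> A y" unfolding k(2) by (rule A_sub[OF k(1) x])
    moreover have "A y \<subseteq> A x" by (subst l(2)) (rule A_sub[OF l(1) y])
    ultimately show ?thesis by (rule subset_antisym)
  qed
  have fin: "finite (A ` carrier G)"
    using finite_image_cosets[OF C G K(1)] A_coset by blast
  define L where "L = \<Inter>(A ` carrier G)"
  have LK: "L \<in> co_normals \<C> ?K"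
    unfolding L_def by (rule co_normals_Inter[OF C gK fin]) (use A in auto)
  \<comment> \<open>The member at the identity is the intersection of K and M, which yields both
    that L lies in K and that L lies in M.\<close>
  have L_sub: "L \<subseteq> A \<one>\<^bsub>G\<^esub>" unfolding L_def by auto
  have "subgroup L ?K" using LK by (auto simp: co_normals_def normal_imp_subgroup)
  then have sL: "subgroup L G" using incl_subgroup[OF sK] by blast
  \<comment> \<open>Conjugation by y permutes the family: the conjugate of a lies in
    \<open>A x\<close> because a lies in the member at the product of x and y.\<close>
  have "y \<otimes>\<^bsub>G\<^esub> a \<otimes>\<^bsub>G\<^esub> inv\<^bsub>G\<^esub> y \<in> L" if y: "y \<in> carrier G" and a: "a \<in> L" for y a
    unfolding L_def
  proof clarify
    fix x assume x: "x \<in> carrier G"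
    have aK: "a \<in> K" using a L_sub by (auto simp: A_def)
    have "(x \<otimes>\<^bsub>G\<^esub> y) \<otimes>\<^bsub>G\<^esub> a \<otimes>\<^bsub>G\<^esub> inv\<^bsub>G\<^esub> (x \<otimes>\<^bsub>G\<^esub> y) \<in> M"
      using a x y by (auto simp: L_def A_def)
    moreover have "(x \<otimes>\<^bsub>G\<^esub> y) \<otimes>\<^bsub>G\<^esub> a \<otimes>\<^bsub>G\<^esub> inv\<^bsub>G\<^esub> (x \<otimes>\<^bsub>G\<^esub> y) =
        x \<otimes>\<^bsub>G\<^esub> (y \<otimes>\<^bsub>G\<^esub> a \<otimes>\<^bsub>G\<^esub> inv\<^bsub>G\<^esub> y) \<otimes>\<^bsub>G\<^esub> inv\<^bsub>G\<^esub> x"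
      using x y Kc[OF aK] by (simp add: m_assoc inv_mult_group)
    ultimately show "y \<otimes>\<^bsub>G\<^esub> a \<otimes>\<^bsub>G\<^esub> inv\<^bsub>G\<^esub> y \<in> A x"
      using conjK[OF y aK] by (simp add: A_def)
  qed
  then have nL: "L \<lhd> G" using sL by (simp add: normal_inv_iff)
  have LK': "L \<subseteq> K" using L_sub by (auto simp: A_def)
  have "L \<subseteq> M"
  proof
    fix a assume "a \<in> L"
    then have "\<one>\<^bsub>G\<^esub> \<otimes>\<^bsub>G\<^esub> a \<otimes>\<^bsub>G\<^esub> inv\<^bsub>G\<^esub> \<one>\<^bsub>G\<^esub> \<in> M" "a \<in> carrier G"
      using L_sub Kc LK' by (auto simp: A_def)
    then show "a \<in> M" by simp
  qed
  with that co_normals_trans[OF C G K(1) nL LK' LK] show thesis by blast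
qed

subsection \<open>The pro-\<open>\<C>\<close> topology and conjugacy separability\<close>

lemma co_normalsD:
  assumes "N \<in> co_normals \<C> G"
  shows "N \<lhd> G" "subgroup N G" "in_class \<C> (G Mod N)"
  using assms by (auto simp: co_normals_def normal_imp_subgroup)

lemma (in group) r_coset_eq_mono:
  assumes N: "subgroup N G" and M: "subgroup M G" "N \<subseteq> M"
    and x: "x \<in> carrier G" and y: "y \<in> carrier G" and eq: "N #> x = N #> y"
  shows "M #> x = M #> y"
proof -
  have "y \<in> M #> x"
    using repr_independenceD[OF N y eq] M(2) by (auto simp: r_coset_def)
  then show ?thesis using repr_independence[OF _ x M(1)] by blast
qed

lemma (in normal) r_coset_eq_mult:
  assumes "x \<in> carrier G" "y \<in> carrier G" "a \<in> carrier G" "b \<in> carrier G" "H #> x = H #> y"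
  shows "H #> (a \<otimes> x \<otimes> b) = H #> (a \<otimes> y \<otimes> b)"
  using assms by (simp flip: rcos_sum)

text \<open>The topology is defined by left cosets while \<open>G Mod N\<close> consists of right
  cosets; normality identifies them. A basic set containing x can be re-centred at x, which removes
  the base point g.\<close>

lemma openin_pro_topology_iff:
  assumes C: "extension_closed_pseudovariety \<C>" and G: "group G"
  shows "openin (pro_topology \<C> G) U \<longleftrightarrow>
    U \<subseteq> carrier G \<and> (\<forall>x\<in>U. \<exists>N\<in>co_normals \<C> G. N #>\<^bsub>G\<^esub> x \<subseteq> U)"
proof -
  interpret group G by fact
  let ?B = "\<lambda>U. \<exists>g\<in>carrier G. \<exists>N\<in>co_normals \<C> G. U = g <#\<^bsub>G\<^esub> N"
  have base: "(\<exists>B. ?B B \<and> x \<in> B \<and> B \<subseteq> U) \<longleftrightarrow>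
      x \<in> carrier G \<and> (\<exists>N\<in>co_normals \<C> G. N #>\<^bsub>G\<^esub> x \<subseteq> U)" (is "?L \<longleftrightarrow> ?R") for x
  proof
    assume ?L
    then obtain g N where N: "g \<in> carrier G" "N \<in> co_normals \<C> G" "x \<in> g <#\<^bsub>G\<^esub> N" "g <#\<^bsub>G\<^esub> N \<subseteq> U"
      by blast
    note n = co_normalsD[OF N(2)]
    have x: "x \<in> carrier G"
      using N(3) l_coset_subset_G[OF subgroup.subset[OF n(2)] N(1)] by blast
    have "g <#\<^bsub>G\<^esub> N = x <#\<^bsub>G\<^esub> N" by (rule l_repr_independence[OF N(3,1) n(2)])
    also have "\<dots> = N #>\<^bsub>G\<^esub> x" using normal.coset_eq[OF n(1)] x by simp
    finally show ?R using x N(2,4) by auto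
  next
    assume ?R
    then obtain N where x: "x \<in> carrier G" and N: "N \<in> co_normals \<C> G" "N #>\<^bsub>G\<^esub> x \<subseteq> U" by blast
    note n = co_normalsD[OF N(1)]
    have "x <#\<^bsub>G\<^esub> N = N #>\<^bsub>G\<^esub> x" using normal.coset_eq[OF n(1)] x by simp
    then show ?L using x N rcos_self[OF x n(2)] by (intro exI[of _ "N #>\<^bsub>G\<^esub> x"]) auto
  qed
  show ?thesis
    unfolding openin_pro_topology[OF C G] arbitrary_union_of_alt base by blast
qed

lemma topspace_pro_topology:
  assumes C: "extension_closed_pseudovariety \<C>" and G: "group G"
  shows "topspace (pro_topology \<C> G) = carrier G"
proof -
  have "openin (pro_topology \<C> G) (carrier G)"
    unfolding openin_pro_topology_iff[OF C G]
    using carrier_in_co_normals[OF C G]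
      monoid.r_coset_subset_G[OF group.is_monoid[OF G] order_refl] by auto
  moreover have "topspace (pro_topology \<C> G) \<subseteq> carrier G"
    using openin_topspace[of "pro_topology \<C> G"]
    unfolding openin_pro_topology_iff[OF C G] by (rule conjunct1)
  ultimately show ?thesis by (intro subset_antisym openin_subset)
qed

text \<open>The coset Ny misses X exactly when no element of X has the same image as y in G/N.
  Closedness thus says that each outside point is told apart from all of X in a single
  quotient.\<close>

lemma closedin_pro_topology_iff:
  assumes C: "extension_closed_pseudovariety \<C>" and G: "group G"
  shows "closedin (pro_topology \<C> G) X \<longleftrightarrow>
    X \<subseteq> carrier G \<and>
    (\<forall>y\<in>carrier G - X. \<exists>N\<in>co_normals \<C> G. \<forall>z\<in>X. N #>\<^bsub>G\<^esub> z \<noteq> N #>\<^bsub>G\<^esub> y)"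
proof -
  interpret group G by fact
  have *: "N #>\<^bsub>G\<^esub> y \<subseteq> carrier G - X \<longleftrightarrow> (\<forall>z\<in>X. N #>\<^bsub>G\<^esub> z \<noteq> N #>\<^bsub>G\<^esub> y)"
    if "X \<subseteq> carrier G" "N \<in> co_normals \<C> G" "y \<in> carrier G" for N y
  proof -
    note sub = co_normalsD(2)[OF that(2)]
    have "z \<in> N #>\<^bsub>G\<^esub> y \<longleftrightarrow> N #>\<^bsub>G\<^esub> z = N #>\<^bsub>G\<^esub> y" if "z \<in> carrier G" for z
      using repr_independence[OF _ \<open>y \<in> carrier G\<close> sub] rcos_self[OF that sub] by metis
    moreover have "N #>\<^bsub>G\<^esub> y \<subseteq> carrier G"
      by (rule r_coset_subset_G[OF subgroup.subset[OF sub] \<open>y \<in> carrier G\<close>])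
    ultimately show ?thesis using that(1) by blast
  qed
  show ?thesis
    unfolding closedin_def topspace_pro_topology[OF C G] openin_pro_topology_iff[OF C G]
    by (rule conj_cong[OF refl]) (simp add: * cong: bex_cong)
qed

text \<open>The contrapositive form of closedness: conjugacy in every quotient G/N implies conjugacy
  in G. Conjugators are taken in G itself, which is the form needed for open subgroups and for the
  completion alike.\<close>

lemma conjugacy_separable_iff:
  assumes C: "extension_closed_pseudovariety \<C>" and G: "group G"
  shows "conjugacy_separable \<C> G \<longleftrightarrow>
    (\<forall>g\<in>carrier G. \<forall>y\<in>carrier G.
       (\<forall>N\<in>co_normals \<C> G. \<exists>h\<in>carrier G.
          N #>\<^bsub>G\<^esub> (h \<otimes>\<^bsub>G\<^esub> g \<otimes>\<^bsub>G\<^esub> inv\<^bsub>G\<^esub> h) = N #>\<^bsub>G\<^esub> y) \<longrightarrow>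
       y \<in> conjugates G g (carrier G))"
proof -
  interpret group G by fact
  have sub: "conjugates G g (carrier G) \<subseteq> carrier G" if "g \<in> carrier G" for g
    using that by (auto simp: conjugates_def)
  have "closedin (pro_topology \<C> G) (conjugates G g (carrier G)) \<longleftrightarrow>
      (\<forall>y\<in>carrier G. (\<forall>N\<in>co_normals \<C> G. \<exists>z\<in>conjugates G g (carrier G).
          N #>\<^bsub>G\<^esub> z = N #>\<^bsub>G\<^esub> y) \<longrightarrow> y \<in> conjugates G g (carrier G))"
    if "g \<in> carrier G" for g
    unfolding closedin_pro_topology_iff[OF C G] using sub[OF that] by (simp add: Ball_def) metis
  moreover have "(\<exists>z\<in>conjugates G g (carrier G). P z) \<longleftrightarrow>
      (\<exists>h\<in>carrier G. P (h \<otimes>\<^bsub>G\<^esub> g \<otimes>\<^bsub>G\<^esub> inv\<^bsub>G\<^esub> h))" for g P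
    unfolding conjugates_def by blast
  ultimately show ?thesis
    unfolding conjugacy_separable_def by simp
qed

section \<open>The centralizer condition and open subgroups\<close>

definition centralizer_condition ::
    "nat monoid set \<Rightarrow> ('a, 'b) monoid_scheme \<Rightarrow> 'a \<Rightarrow> bool" where
  "centralizer_condition \<C> G g \<longleftrightarrow>
     (\<forall>K\<in>co_normals \<C> G. \<exists>L\<in>co_normals \<C> G. L \<subseteq> K \<and>
        (\<forall>x\<in>carrier G. L #>\<^bsub>G\<^esub> (x \<otimes>\<^bsub>G\<^esub> g) = L #>\<^bsub>G\<^esub> (g \<otimes>\<^bsub>G\<^esub> x) \<longrightarrow>
           (\<exists>c\<in>centralizer G g. K #>\<^bsub>G\<^esub> x = K #>\<^bsub>G\<^esub> c)))"

lemma (in group) subgroup_centralizer: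
  assumes g: "g \<in> carrier G"
  shows "subgroup (centralizer G g) G"
proof (rule subgroupI)
  show "centralizer G g \<subseteq> carrier G" by (auto simp: centralizer_def)
  show "centralizer G g \<noteq> {}" using g by (auto simp: centralizer_def)
next
  fix a assume "a \<in> centralizer G g"
  then have a: "a \<in> carrier G" "a \<otimes> g = g \<otimes> a" by (auto simp: centralizer_def)
  have "inv a \<otimes> g = inv a \<otimes> (g \<otimes> a) \<otimes> inv a"
    using a(1) g by (simp add: m_assoc)
  also have "\<dots> = inv a \<otimes> (a \<otimes> g) \<otimes> inv a" by (simp only: a(2))
  also have "\<dots> = g \<otimes> inv a" using a(1) g by (simp add: m_assoc[symmetric])
  finally show "inv a \<in> centralizer G g" using a(1) by (simp add: centralizer_def)
next
  fix a b assume "a \<in> centralizer G g" "b \<in> centralizer G g"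
  then have a: "a \<in> carrier G" "a \<otimes> g = g \<otimes> a" and b: "b \<in> carrier G" "b \<otimes> g = g \<otimes> b"
    by (auto simp: centralizer_def)
  have "a \<otimes> b \<otimes> g = a \<otimes> g \<otimes> b" using a(1) b g by (simp add: m_assoc)
  also have "\<dots> = g \<otimes> (a \<otimes> b)" using a b(1) g by (simp add: m_assoc)
  finally show "a \<otimes> b \<in> centralizer G g" using a(1) b(1) by (simp add: centralizer_def)
qed

text \<open>Conjugacy separability of G yields a conjugator g from h to y that may lie outside H.
  All other conjugators are products gc with c centralizing h, and the centralizer condition finds
  such a c with gc in H.\<close>

lemma conjugacy_separable_open_subgroup:
  assumes C: "extension_closed_pseudovariety \<C>" and G: "group G"
    and cs: "conjugacy_separable \<C> G"
    and cc: "\<And>g. g \<in> carrier G \<Longrightarrow> centralizer_condition \<C> G g"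
    and H: "subgroup H G" "openin (pro_topology \<C> G) H"
  shows "conjugacy_separable \<C> (G\<lparr>carrier := H\<rparr>)"
proof -
  interpret group G by fact
  let ?H = "G\<lparr>carrier := H\<rparr>"
  have gH: "group ?H" using subgroup_imp_group[OF H(1)] .
  have Hc: "x \<in> carrier G" if "x \<in> H" for x using subgroup.mem_carrier[OF H(1) that] .
  obtain K where K: "K \<in> co_normals \<C> G" "K #>\<^bsub>G\<^esub> \<one>\<^bsub>G\<^esub> \<subseteq> H"
    using H(2) subgroup.one_closed[OF H(1)] unfolding openin_pro_topology_iff[OF C G] by blast
  have nK: "K \<lhd> G" and sK: "subgroup K G" using co_normalsD[OF K(1)] by auto
  have KH: "K \<subseteq> H" using K(2) coset_mult_one[OF subgroup.subset[OF sK]] by simp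
  show ?thesis
    unfolding conjugacy_separable_iff[OF C gH]
  proof (intro ballI impI)
    fix h y assume "h \<in> carrier ?H" "y \<in> carrier ?H"
      and "\<forall>N\<in>co_normals \<C> ?H. \<exists>k\<in>carrier ?H.
        N #>\<^bsub>?H\<^esub> (k \<otimes>\<^bsub>?H\<^esub> h \<otimes>\<^bsub>?H\<^esub> inv\<^bsub>?H\<^esub> k) = N #>\<^bsub>?H\<^esub> y"
    then have h: "h \<in> H" and y: "y \<in> H" and hy: "\<And>N. N \<in> co_normals \<C> ?H \<Longrightarrow>
        \<exists>k\<in>H. N #>\<^bsub>G\<^esub> (k \<otimes>\<^bsub>G\<^esub> h \<otimes>\<^bsub>G\<^esub> inv\<^bsub>G\<^esub> k) = N #>\<^bsub>G\<^esub> y"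
      using H(1) by (auto simp: r_coset_def)
    note hc = Hc[OF h] and yc = Hc[OF y]
    \<comment> \<open>The intersection of N with H is co-\<C> in H, so congruence modulo it is
      available and implies congruence modulo N.\<close>
    have conj: "\<exists>k\<in>H. N #>\<^bsub>G\<^esub> (k \<otimes>\<^bsub>G\<^esub> h \<otimes>\<^bsub>G\<^esub> inv\<^bsub>G\<^esub> k) = N #>\<^bsub>G\<^esub> y"
      if N: "N \<in> co_normals \<C> G" for N
    proof -
      let ?M = "{a \<in> carrier ?H. a \<in> N}"
      have "(\<lambda>a. a) \<in> hom ?H G" using Hc by (auto simp: hom_def)
      from vimage_in_co_normals[OF C gH G this N] have M: "?M \<in> co_normals \<C> ?H" .
      obtain k where k: "k \<in> H"
        "?M #>\<^bsub>G\<^esub> (k \<otimes>\<^bsub>G\<^esub> h \<otimes>\<^bsub>G\<^esub> inv\<^bsub>G\<^esub> k) = ?M #>\<^bsub>G\<^esub> y"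
        using hy[OF M] by blast
      have "subgroup ?M G" using incl_subgroup[OF H(1) co_normalsD(2)[OF M]] .
      then have "N #>\<^bsub>G\<^esub> (k \<otimes>\<^bsub>G\<^esub> h \<otimes>\<^bsub>G\<^esub> inv\<^bsub>G\<^esub> k) = N #>\<^bsub>G\<^esub> y"
        using r_coset_eq_mono[OF _ co_normalsD(2)[OF N] _ _ yc k(2)] hc Hc[OF k(1)] by auto
      then show ?thesis using k(1) by blast
    qed
    then have "\<forall>N\<in>co_normals \<C> G. \<exists>k\<in>carrier G.
        N #>\<^bsub>G\<^esub> (k \<otimes>\<^bsub>G\<^esub> h \<otimes>\<^bsub>G\<^esub> inv\<^bsub>G\<^esub> k) = N #>\<^bsub>G\<^esub> y"
      using Hc by metis
    then have "y \<in> conjugates G h (carrier G)"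
      using cs[unfolded conjugacy_separable_iff[OF C G]] hc yc by simp
    then obtain g where g: "g \<in> carrier G" "y = g \<otimes>\<^bsub>G\<^esub> h \<otimes>\<^bsub>G\<^esub> inv\<^bsub>G\<^esub> g"
      by (auto simp: conjugates_def)
    obtain L where L: "L \<in> co_normals \<C> G"
      "\<And>x. x \<in> carrier G \<Longrightarrow> L #>\<^bsub>G\<^esub> (x \<otimes>\<^bsub>G\<^esub> h) = L #>\<^bsub>G\<^esub> (h \<otimes>\<^bsub>G\<^esub> x) \<Longrightarrow>
           \<exists>c\<in>centralizer G h. K #>\<^bsub>G\<^esub> x = K #>\<^bsub>G\<^esub> c"
      using cc[OF hc] K(1) unfolding centralizer_condition_def by metis
    obtain k where k: "k \<in> H" "L #>\<^bsub>G\<^esub> (k \<otimes>\<^bsub>G\<^esub> h \<otimes>\<^bsub>G\<^esub> inv\<^bsub>G\<^esub> k) = L #>\<^bsub>G\<^esub> y"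
      using conj[OF L(1)] by blast
    note kc = Hc[OF k(1)]
    \<comment> \<open>Both g and k conjugate h to y, the first exactly and the second modulo L.
      Hence g^-1 k centralizes h modulo L, and the choice of L places it in the coset Kc of an exact
      centralizer c.\<close>
    let ?x = "inv\<^bsub>G\<^esub> g \<otimes>\<^bsub>G\<^esub> k"
    have "L #>\<^bsub>G\<^esub> (inv\<^bsub>G\<^esub> g \<otimes>\<^bsub>G\<^esub> (k \<otimes>\<^bsub>G\<^esub> h \<otimes>\<^bsub>G\<^esub> inv\<^bsub>G\<^esub> k) \<otimes>\<^bsub>G\<^esub> k) =
        L #>\<^bsub>G\<^esub> (inv\<^bsub>G\<^esub> g \<otimes>\<^bsub>G\<^esub> y \<otimes>\<^bsub>G\<^esub> k)"
      by (rule normal.r_coset_eq_mult[OF co_normalsD(1)[OF L(1)] _ _ _ _ k(2)])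
        (use hc yc kc g(1) in auto)
    moreover have "inv\<^bsub>G\<^esub> g \<otimes>\<^bsub>G\<^esub> (k \<otimes>\<^bsub>G\<^esub> h \<otimes>\<^bsub>G\<^esub> inv\<^bsub>G\<^esub> k) \<otimes>\<^bsub>G\<^esub> k = ?x \<otimes>\<^bsub>G\<^esub> h"
      using hc kc g(1) by (simp add: m_assoc)
    moreover have "inv\<^bsub>G\<^esub> g \<otimes>\<^bsub>G\<^esub> y \<otimes>\<^bsub>G\<^esub> k = h \<otimes>\<^bsub>G\<^esub> ?x"
      using hc kc g by (simp add: m_assoc[symmetric])
    ultimately obtain c where c: "c \<in> centralizer G h" "K #>\<^bsub>G\<^esub> ?x = K #>\<^bsub>G\<^esub> c"
      using L(2)[of ?x] kc g(1) by auto
    have cc: "c \<in> carrier G" "c \<otimes>\<^bsub>G\<^esub> h = h \<otimes>\<^bsub>G\<^esub> c" using c(1) by (auto simp: centralizer_def)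
    \<comment> \<open>Multiplying by g on the left gives Kk = Kgc, so gc lies in Kk, which is inside
      H. The trailing identity only fits the two-sided shape of
      \<open>r_coset_eq_mult\<close>.\<close>
    have "K #>\<^bsub>G\<^esub> (g \<otimes>\<^bsub>G\<^esub> ?x \<otimes>\<^bsub>G\<^esub> \<one>\<^bsub>G\<^esub>) = K #>\<^bsub>G\<^esub> (g \<otimes>\<^bsub>G\<^esub> c \<otimes>\<^bsub>G\<^esub> \<one>\<^bsub>G\<^esub>)"
      by (rule normal.r_coset_eq_mult[OF nK _ _ _ _ c(2)]) (use kc g(1) cc in auto)
    then have "K #>\<^bsub>G\<^esub> k = K #>\<^bsub>G\<^esub> (g \<otimes>\<^bsub>G\<^esub> c)"
      using kc g(1) cc by (simp add: m_assoc[symmetric])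
    then have "g \<otimes>\<^bsub>G\<^esub> c \<in> K #>\<^bsub>G\<^esub> k"
      using repr_independenceD[OF sK, of "g \<otimes>\<^bsub>G\<^esub> c" k] g(1) cc by simp
    then have gc: "g \<otimes>\<^bsub>G\<^esub> c \<in> H"
      using KH subgroup.m_closed[OF H(1)] k(1) by (auto simp: r_coset_def)
    have "(g \<otimes>\<^bsub>G\<^esub> c) \<otimes>\<^bsub>G\<^esub> h \<otimes>\<^bsub>G\<^esub> inv\<^bsub>G\<^esub> (g \<otimes>\<^bsub>G\<^esub> c) =
        g \<otimes>\<^bsub>G\<^esub> (c \<otimes>\<^bsub>G\<^esub> h) \<otimes>\<^bsub>G\<^esub> inv\<^bsub>G\<^esub> c \<otimes>\<^bsub>G\<^esub> inv\<^bsub>G\<^esub> g"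
      using cc(1) g(1) hc by (simp add: m_assoc inv_mult_group)
    also have "\<dots> = y" using cc(1) g hc by (simp add: cc(2) m_assoc)
    finally show "y \<in> conjugates ?H h (carrier ?H)"
      using gc H(1) by (auto simp: conjugates_def intro!: exI[of _ "g \<otimes>\<^bsub>G\<^esub> c"])
  qed
qed

text \<open>
  Hereditary conjugacy separability is applied to the open subgroup \<open>H = K C\<^sub>G(g)\<close>, in which
  the conjugates of \<open>g\<close> are already the conjugates under \<open>K\<close>.
\<close>

lemma hereditarily_conjugacy_separable_imp_centralizer_condition:
  assumes C: "extension_closed_pseudovariety \<C>" and G: "group G"
    and hcs: "hereditarily_conjugacy_separable \<C> G" and g: "g \<in> carrier G"
  shows "centralizer_condition \<C> G g"
  unfolding centralizer_condition_def
proof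
  fix K assume K: "K \<in> co_normals \<C> G"
  interpret group G by fact
  have nK: "K \<lhd> G" and sK: "subgroup K G" and cK: "in_class \<C> (G Mod K)"
    using co_normalsD[OF K] by auto
  let ?C = "centralizer G g"
  have sC: "subgroup ?C G" by (rule subgroup_centralizer[OF g])
  have Kc: "x \<in> carrier G" if "x \<in> K" for x using subgroup.mem_carrier[OF sK that] .
  define H where "H = K <#>\<^bsub>G\<^esub> ?C"
  let ?H = "G\<lparr>carrier := H\<rparr>"
  have H: "subgroup H G" unfolding H_def by (rule mult_norm_subgroup[OF nK sC])
  have gH: "group ?H" using subgroup_imp_group[OF H] .
  have Hc: "x \<in> carrier G" if "x \<in> H" for x using subgroup.mem_carrier[OF H that] .
  have KH: "K \<subseteq> H"
  proof
    fix k assume k: "k \<in> K"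
    then have "k = k \<otimes>\<^bsub>G\<^esub> \<one>\<^bsub>G\<^esub>" using Kc by simp
    with k subgroup.one_closed[OF sC] show "k \<in> H" unfolding H_def set_mult_def by blast
  qed
  have gH': "g \<in> H"
  proof -
    have "g = \<one>\<^bsub>G\<^esub> \<otimes>\<^bsub>G\<^esub> g" "g \<in> ?C" using g by (auto simp: centralizer_def)
    with subgroup.one_closed[OF sK] show ?thesis unfolding H_def set_mult_def by blast
  qed
  have K_coset: "K #>\<^bsub>G\<^esub> x \<subseteq> H" if "x \<in> H" for x
    using subgroup.m_closed[OF H] KH that by (auto simp: r_coset_def)
  have "openin (pro_topology \<C> G) H"
    unfolding openin_pro_topology_iff[OF C G]
    using K K_coset subgroup.subset[OF H] by blast
  then have csH: "conjugacy_separable \<C> ?H"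
    using hcs H by (simp add: hereditarily_conjugacy_separable_def)
  have conj_H: "\<exists>k\<in>K. h \<otimes>\<^bsub>G\<^esub> g \<otimes>\<^bsub>G\<^esub> inv\<^bsub>G\<^esub> h = k \<otimes>\<^bsub>G\<^esub> g \<otimes>\<^bsub>G\<^esub> inv\<^bsub>G\<^esub> k" if hH: "h \<in> H" for h
  proof -
    obtain k c where h: "h = k \<otimes>\<^bsub>G\<^esub> c" and k: "k \<in> K" and "c \<in> ?C"
      using hH by (auto simp: H_def set_mult_def)
    then have c: "c \<in> carrier G" "c \<otimes>\<^bsub>G\<^esub> g = g \<otimes>\<^bsub>G\<^esub> c" by (auto simp: centralizer_def)
    have "h \<otimes>\<^bsub>G\<^esub> g \<otimes>\<^bsub>G\<^esub> inv\<^bsub>G\<^esub> h = k \<otimes>\<^bsub>G\<^esub> (c \<otimes>\<^bsub>G\<^esub> g) \<otimes>\<^bsub>G\<^esub> inv\<^bsub>G\<^esub> c \<otimes>\<^bsub>G\<^esub> inv\<^bsub>G\<^esub> k"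
      unfolding h using Kc[OF k] c(1) g by (simp add: m_assoc inv_mult_group)
    also have "\<dots> = k \<otimes>\<^bsub>G\<^esub> g \<otimes>\<^bsub>G\<^esub> inv\<^bsub>G\<^esub> k"
      using Kc[OF k] c(1) g by (simp add: c(2) m_assoc)
    finally show ?thesis using k by blast
  qed
  \<comment> \<open>The bad cosets are those outside the image of the centralizer in G/K. There are
    finitely many, so it suffices to exclude each by its own quotient and then to intersect.\<close>
  define bad where "bad = (\<lambda>X. \<forall>c\<in>?C. X \<noteq> K #>\<^bsub>G\<^esub> c)"
  have sep: "\<exists>M\<in>co_normals \<C> G. \<forall>k\<in>K. M #>\<^bsub>G\<^esub> (k \<otimes>\<^bsub>G\<^esub> g \<otimes>\<^bsub>G\<^esub> inv\<^bsub>G\<^esub> k) \<noteq> M #>\<^bsub>G\<^esub> y"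
    if x: "x \<in> carrier G" and bad: "bad (K #>\<^bsub>G\<^esub> x)" and y: "y = inv\<^bsub>G\<^esub> x \<otimes>\<^bsub>G\<^esub> g \<otimes>\<^bsub>G\<^esub> x" for x y
  proof (cases "y \<in> H")
    \<comment> \<open>H is a union of cosets of K and contains every conjugate of g by an element of
      K, so K itself separates y from all of them.\<close>
    case False
    have "K #>\<^bsub>G\<^esub> (k \<otimes>\<^bsub>G\<^esub> g \<otimes>\<^bsub>G\<^esub> inv\<^bsub>G\<^esub> k) \<noteq> K #>\<^bsub>G\<^esub> y" if k: "k \<in> K" for k
    proof
      assume eq: "K #>\<^bsub>G\<^esub> (k \<otimes>\<^bsub>G\<^esub> g \<otimes>\<^bsub>G\<^esub> inv\<^bsub>G\<^esub> k) = K #>\<^bsub>G\<^esub> y"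
      have "k \<otimes>\<^bsub>G\<^esub> g \<otimes>\<^bsub>G\<^esub> inv\<^bsub>G\<^esub> k \<in> H"
        using k KH gH' subgroup.m_closed[OF H] subgroup.m_inv_closed[OF H] by blast
      moreover have "y \<in> K #>\<^bsub>G\<^esub> (k \<otimes>\<^bsub>G\<^esub> g \<otimes>\<^bsub>G\<^esub> inv\<^bsub>G\<^esub> k)"
        by (rule repr_independenceD[OF sK _ eq]) (use x g y in simp)
      ultimately show False using K_coset False by blast
    qed
    with K show ?thesis by blast
  next
    case True
    \<comment> \<open>If y were conjugate to g in H, it would be k g k^-1 with k in K. Then xk
      centralizes g, and Kx = Kxk by normality of K, so the coset of x would not be bad.\<close>
    have "y \<notin> conjugates ?H g (carrier ?H)"
    proof
      assume "y \<in> conjugates ?H g (carrier ?H)"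
      then obtain h where "h \<in> H" "y = h \<otimes>\<^bsub>G\<^esub> g \<otimes>\<^bsub>G\<^esub> inv\<^bsub>G\<^esub> h"
        using H by (auto simp: conjugates_def)
      then obtain k where k: "k \<in> K" "y = k \<otimes>\<^bsub>G\<^esub> g \<otimes>\<^bsub>G\<^esub> inv\<^bsub>G\<^esub> k"
        using conj_H by metis
      note kc = Kc[OF k(1)]
      have "(x \<otimes>\<^bsub>G\<^esub> k) \<otimes>\<^bsub>G\<^esub> g = x \<otimes>\<^bsub>G\<^esub> (k \<otimes>\<^bsub>G\<^esub> g \<otimes>\<^bsub>G\<^esub> inv\<^bsub>G\<^esub> k) \<otimes>\<^bsub>G\<^esub> k"
        using x kc g by (simp add: m_assoc)
      also have "\<dots> = x \<otimes>\<^bsub>G\<^esub> (inv\<^bsub>G\<^esub> x \<otimes>\<^bsub>G\<^esub> g \<otimes>\<^bsub>G\<^esub> x) \<otimes>\<^bsub>G\<^esub> k"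
        using k(2) y by simp
      also have "\<dots> = g \<otimes>\<^bsub>G\<^esub> (x \<otimes>\<^bsub>G\<^esub> k)"
        using x kc g by (simp add: m_assoc[symmetric])
      finally have xk: "x \<otimes>\<^bsub>G\<^esub> k \<in> ?C" using x kc by (simp add: centralizer_def)
      have "K #>\<^bsub>G\<^esub> (x \<otimes>\<^bsub>G\<^esub> k \<otimes>\<^bsub>G\<^esub> \<one>\<^bsub>G\<^esub>) = K #>\<^bsub>G\<^esub> (x \<otimes>\<^bsub>G\<^esub> \<one>\<^bsub>G\<^esub> \<otimes>\<^bsub>G\<^esub> \<one>\<^bsub>G\<^esub>)"
        by (rule normal.r_coset_eq_mult[OF nK])
          (use x kc coset_join2[OF kc sK k(1)] coset_mult_one[OF subgroup.subset[OF sK]] in auto)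
      then have "K #>\<^bsub>G\<^esub> x = K #>\<^bsub>G\<^esub> (x \<otimes>\<^bsub>G\<^esub> k)" using x kc by simp
      with xk bad show False unfolding bad_def by blast
    qed
    moreover have "y \<in> conjugates ?H g (carrier ?H)"
      if "\<forall>N\<in>co_normals \<C> ?H. \<exists>h\<in>carrier ?H.
        N #>\<^bsub>?H\<^esub> (h \<otimes>\<^bsub>?H\<^esub> g \<otimes>\<^bsub>?H\<^esub> inv\<^bsub>?H\<^esub> h) = N #>\<^bsub>?H\<^esub> y"
      by (rule csH[unfolded conjugacy_separable_iff[OF C gH], rule_format])
        (use gH' True in simp, use True in simp, rule bspec[OF that])
    ultimately obtain M0 where M0: "M0 \<in> co_normals \<C> ?H"
      and ne: "\<And>h. h \<in> carrier ?H \<Longrightarrow>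
        M0 #>\<^bsub>?H\<^esub> (h \<otimes>\<^bsub>?H\<^esub> g \<otimes>\<^bsub>?H\<^esub> inv\<^bsub>?H\<^esub> h) \<noteq> M0 #>\<^bsub>?H\<^esub> y"
      by metis
    \<comment> \<open>M0 is co-\<C> only in H. Shrinking it to a co-\<C> subgroup of G preserves the
      separation.\<close>
    obtain M where M: "M \<in> co_normals \<C> G" "M \<subseteq> M0"
      using co_normals_of_open_subgroup[OF C G H K KH M0] .
    have "M #>\<^bsub>G\<^esub> (k \<otimes>\<^bsub>G\<^esub> g \<otimes>\<^bsub>G\<^esub> inv\<^bsub>G\<^esub> k) \<noteq> M #>\<^bsub>G\<^esub> y" if k: "k \<in> K" for k
    proof
      assume eq: "M #>\<^bsub>G\<^esub> (k \<otimes>\<^bsub>G\<^esub> g \<otimes>\<^bsub>G\<^esub> inv\<^bsub>G\<^esub> k) = M #>\<^bsub>G\<^esub> y"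
      have "subgroup M0 G" using incl_subgroup[OF H co_normalsD(2)[OF M0]] .
      from r_coset_eq_mono[OF co_normalsD(2)[OF M(1)] this M(2) _ Hc[OF True] eq]
      have "M0 #>\<^bsub>G\<^esub> (k \<otimes>\<^bsub>G\<^esub> g \<otimes>\<^bsub>G\<^esub> inv\<^bsub>G\<^esub> k) = M0 #>\<^bsub>G\<^esub> y" using Kc[OF k] g by simp
      moreover have "k \<in> H" using k KH by blast
      ultimately show False using ne[of k] H by (simp add: r_coset_def)
    qed
    with M(1) show ?thesis by blast
  qed
  \<comment> \<open>One M has to serve the whole coset X. Writing x' = xk and conjugating by x^-1
    turns the equation x' g x'^-1 = g modulo M into k g k^-1 = x^-1 g x modulo M, which
    \<open>sep\<close> excludes for all k in K at once. Keeping \<open>bad X\<close> inside the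
    existential gives a total choice of M.\<close>
  have "\<exists>M\<in>co_normals \<C> G. bad X \<longrightarrow>
      (\<forall>x\<in>X. M #>\<^bsub>G\<^esub> (x \<otimes>\<^bsub>G\<^esub> g \<otimes>\<^bsub>G\<^esub> inv\<^bsub>G\<^esub> x) \<noteq> M #>\<^bsub>G\<^esub> g)" if XK: "X \<in> carrier (G Mod K)" for X
  proof (cases "bad X")
    case False
    then show ?thesis using K by blast
  next
    case True
    obtain x where x: "x \<in> carrier G" and X: "X = K #>\<^bsub>G\<^esub> x"
      using XK by (auto simp: carrier_FactGroup)
    obtain M where M: "M \<in> co_normals \<C> G" and ne: "\<And>k. k \<in> K \<Longrightarrow>
        M #>\<^bsub>G\<^esub> (k \<otimes>\<^bsub>G\<^esub> g \<otimes>\<^bsub>G\<^esub> inv\<^bsub>G\<^esub> k) \<noteq> M #>\<^bsub>G\<^esub> (inv\<^bsub>G\<^esub> x \<otimes>\<^bsub>G\<^esub> g \<otimes>\<^bsub>G\<^esub> x)"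
      using sep[OF x True[unfolded X] refl] by blast
    have "M #>\<^bsub>G\<^esub> (x' \<otimes>\<^bsub>G\<^esub> g \<otimes>\<^bsub>G\<^esub> inv\<^bsub>G\<^esub> x') \<noteq> M #>\<^bsub>G\<^esub> g" if x': "x' \<in> X" for x'
    proof
      assume eq: "M #>\<^bsub>G\<^esub> (x' \<otimes>\<^bsub>G\<^esub> g \<otimes>\<^bsub>G\<^esub> inv\<^bsub>G\<^esub> x') = M #>\<^bsub>G\<^esub> g"
      have "x' \<in> x <#\<^bsub>G\<^esub> K" using x' X normal.coset_eq[OF nK] x by simp
      then obtain k where k: "k \<in> K" "x' = x \<otimes>\<^bsub>G\<^esub> k" by (auto simp: l_coset_def)
      note kc = Kc[OF k(1)]
      have "M #>\<^bsub>G\<^esub> (inv\<^bsub>G\<^esub> x \<otimes>\<^bsub>G\<^esub> (x' \<otimes>\<^bsub>G\<^esub> g \<otimes>\<^bsub>G\<^esub> inv\<^bsub>G\<^esub> x') \<otimes>\<^bsub>G\<^esub> x) =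
          M #>\<^bsub>G\<^esub> (inv\<^bsub>G\<^esub> x \<otimes>\<^bsub>G\<^esub> g \<otimes>\<^bsub>G\<^esub> x)"
        by (rule normal.r_coset_eq_mult[OF co_normalsD(1)[OF M] _ _ _ _ eq])
          (use x kc g k(2) in auto)
      moreover have "inv\<^bsub>G\<^esub> x \<otimes>\<^bsub>G\<^esub> (x' \<otimes>\<^bsub>G\<^esub> g \<otimes>\<^bsub>G\<^esub> inv\<^bsub>G\<^esub> x') \<otimes>\<^bsub>G\<^esub> x =
          k \<otimes>\<^bsub>G\<^esub> g \<otimes>\<^bsub>G\<^esub> inv\<^bsub>G\<^esub> k"
        unfolding k(2) using x kc g by (simp add: m_assoc inv_mult_group)
          (simp add: m_assoc[symmetric])
      ultimately show False using ne[OF k(1)] by simp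
    qed
    with M show ?thesis by blast
  qed
  then obtain M where M: "\<And>X. X \<in> carrier (G Mod K) \<Longrightarrow> M X \<in> co_normals \<C> G"
    "\<And>X x. X \<in> carrier (G Mod K) \<Longrightarrow> bad X \<Longrightarrow> x \<in> X \<Longrightarrow>
      M X #>\<^bsub>G\<^esub> (x \<otimes>\<^bsub>G\<^esub> g \<otimes>\<^bsub>G\<^esub> inv\<^bsub>G\<^esub> x) \<noteq> M X #>\<^bsub>G\<^esub> g"
    by metis
  \<comment> \<open>Inserting K forces L to lie in K. An x that commutes with g modulo L fixes g
    under conjugation modulo every \<open>M X\<close>, so its own coset cannot be bad.\<close>
  define L where "L = \<Inter>(insert K (M ` carrier (G Mod K)))"
  have L: "L \<in> co_normals \<C> G"
    unfolding L_def by (rule co_normals_Inter[OF C G]) (use in_class_finite[OF C cK] K M(1) in auto)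
  have "\<exists>c\<in>?C. K #>\<^bsub>G\<^esub> x = K #>\<^bsub>G\<^esub> c"
    if x: "x \<in> carrier G" and eq: "L #>\<^bsub>G\<^esub> (x \<otimes>\<^bsub>G\<^esub> g) = L #>\<^bsub>G\<^esub> (g \<otimes>\<^bsub>G\<^esub> x)" for x
  proof (rule ccontr)
    assume "\<not> (\<exists>c\<in>?C. K #>\<^bsub>G\<^esub> x = K #>\<^bsub>G\<^esub> c)"
    then have bad: "bad (K #>\<^bsub>G\<^esub> x)" by (simp add: bad_def)
    let ?X = "K #>\<^bsub>G\<^esub> x"
    have X: "?X \<in> carrier (G Mod K)" using x by (auto simp: carrier_FactGroup)
    have "L #>\<^bsub>G\<^esub> (\<one>\<^bsub>G\<^esub> \<otimes>\<^bsub>G\<^esub> (x \<otimes>\<^bsub>G\<^esub> g) \<otimes>\<^bsub>G\<^esub> inv\<^bsub>G\<^esub> x) =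
        L #>\<^bsub>G\<^esub> (\<one>\<^bsub>G\<^esub> \<otimes>\<^bsub>G\<^esub> (g \<otimes>\<^bsub>G\<^esub> x) \<otimes>\<^bsub>G\<^esub> inv\<^bsub>G\<^esub> x)"
      by (rule normal.r_coset_eq_mult[OF co_normalsD(1)[OF L] _ _ _ _ eq]) (use x g in auto)
    then have Lg: "L #>\<^bsub>G\<^esub> (x \<otimes>\<^bsub>G\<^esub> g \<otimes>\<^bsub>G\<^esub> inv\<^bsub>G\<^esub> x) = L #>\<^bsub>G\<^esub> g"
      using x g by (simp add: m_assoc)
    have LM: "L \<subseteq> M ?X" unfolding L_def using X by blast
    have "M ?X #>\<^bsub>G\<^esub> (x \<otimes>\<^bsub>G\<^esub> g \<otimes>\<^bsub>G\<^esub> inv\<^bsub>G\<^esub> x) = M ?X #>\<^bsub>G\<^esub> g"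
      by (rule r_coset_eq_mono[OF co_normalsD(2)[OF L] co_normalsD(2)[OF M(1)[OF X]] LM _ g Lg])
        (use x g in simp)
    then show False using M(2)[OF X bad rcos_self[OF x sK]] by blast
  qed
  moreover have "L \<subseteq> K" unfolding L_def by blast
  ultimately show "\<exists>L\<in>co_normals \<C> G. L \<subseteq> K \<and>
        (\<forall>x\<in>carrier G. L #>\<^bsub>G\<^esub> (x \<otimes>\<^bsub>G\<^esub> g) = L #>\<^bsub>G\<^esub> (g \<otimes>\<^bsub>G\<^esub> x) \<longrightarrow>
           (\<exists>c\<in>?C. K #>\<^bsub>G\<^esub> x = K #>\<^bsub>G\<^esub> c))"
    using L by blast
qed

lemma hereditarily_conjugacy_separable_iff:
  assumes C: "extension_closed_pseudovariety \<C>" and G: "group G"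
  shows "hereditarily_conjugacy_separable \<C> G \<longleftrightarrow>
    conjugacy_separable \<C> G \<and> (\<forall>g\<in>carrier G. centralizer_condition \<C> G g)"
  using hereditarily_conjugacy_separable_imp_centralizer_condition[OF C G]
    conjugacy_separable_open_subgroup[OF C G]
  by (auto simp: hereditarily_conjugacy_separable_def)

subsection \<open>The pro-\<open>\<C>\<close> completion\<close>

lemma carrier_pro_completion_iff:
  "x \<in> carrier (pro_completion \<C> G) \<longleftrightarrow>
    x \<in> (\<Pi>\<^sub>E N\<in>co_normals \<C> G. carrier (G Mod N)) \<and>
    (\<forall>N\<in>co_normals \<C> G. \<forall>M\<in>co_normals \<C> G. N \<subseteq> M \<longrightarrow>
      (\<forall>g\<in>carrier G. x N = N #>\<^bsub>G\<^esub> g \<longrightarrow> x M = M #>\<^bsub>G\<^esub> g))"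
  by (simp add: pro_completion_def)

lemma pro_completion_rep:
  assumes "x \<in> carrier (pro_completion \<C> G)" "N \<in> co_normals \<C> G"
  obtains g where "g \<in> carrier G" "x N = N #>\<^bsub>G\<^esub> g"
proof -
  have "x N \<in> carrier (G Mod N)"
    using PiE_mem[OF conjunct1[OF assms(1)[unfolded carrier_pro_completion_iff]] assms(2)] .
  with that show thesis by (auto simp: carrier_FactGroup)
qed

lemma pro_completion_compat:
  assumes "x \<in> carrier (pro_completion \<C> G)" "N \<in> co_normals \<C> G" "M \<in> co_normals \<C> G" "N \<subseteq> M"
    "g \<in> carrier G" "x N = N #>\<^bsub>G\<^esub> g"
  shows "x M = M #>\<^bsub>G\<^esub> g"
  using conjunct2[OF assms(1)[unfolded carrier_pro_completion_iff], rule_format, OF assms(2-)] .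

text \<open>The carrier demands compatibility for every representative of \<open>x N\<close>. One
  common representative is enough, since for N inside M all representatives of a coset of N lie in
  one coset of M.\<close>

lemma pro_completion_memI:
  assumes G: "group G" and x: "x \<in> (\<Pi>\<^sub>E N\<in>co_normals \<C> G. carrier (G Mod N))"
    and c: "\<And>N M. N \<in> co_normals \<C> G \<Longrightarrow> M \<in> co_normals \<C> G \<Longrightarrow> N \<subseteq> M \<Longrightarrow>
      \<exists>g\<in>carrier G. x N = N #>\<^bsub>G\<^esub> g \<and> x M = M #>\<^bsub>G\<^esub> g"
  shows "x \<in> carrier (pro_completion \<C> G)"
proof -
  have "x M = M #>\<^bsub>G\<^esub> g"
    if N: "N \<in> co_normals \<C> G" and M: "M \<in> co_normals \<C> G" and NM: "N \<subseteq> M"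
      and g: "g \<in> carrier G" and xg: "x N = N #>\<^bsub>G\<^esub> g" for N M g
  proof -
    obtain h where h: "h \<in> carrier G" "x N = N #>\<^bsub>G\<^esub> h" "x M = M #>\<^bsub>G\<^esub> h"
      using c[OF N M NM] by blast
    have "M #>\<^bsub>G\<^esub> h = M #>\<^bsub>G\<^esub> g"
      by (rule group.r_coset_eq_mono[OF G co_normalsD(2)[OF N] co_normalsD(2)[OF M] NM h(1) g])
        (use h(2) xg in simp)
    then show ?thesis using h(3) by simp
  qed
  with x show ?thesis unfolding carrier_pro_completion_iff by blast
qed

lemma pro_completion_eqI:
  assumes "x \<in> carrier (pro_completion \<C> G)" "y \<in> carrier (pro_completion \<C> G)"
    and "\<And>N. N \<in> co_normals \<C> G \<Longrightarrow> x N = y N"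
  shows "x = y"
  by (rule PiE_ext[OF conjunct1[OF assms(1)[unfolded carrier_pro_completion_iff]]
        conjunct1[OF assms(2)[unfolded carrier_pro_completion_iff]] assms(3)])

text \<open>The compatible families form a subgroup of the product. By compatibility a
  representative at N also serves at any M containing N, so products and inverses of families again
  have common representatives.\<close>

lemma pro_completion_group:
  assumes G: "group G"
  shows "group (pro_completion \<C> G)"
proof -
  interpret group G by fact
  let ?I = "co_normals \<C> G"
  let ?P = "product_group ?I (\<lambda>N. G Mod N)"
  have gq: "group (G Mod N)" if "N \<in> ?I" for N
    using normal.factorgroup_is_group[OF co_normalsD(1)[OF that]] .
  have gP: "group ?P" using gq by simp
  have subP: "carrier (pro_completion \<C> G) \<subseteq> carrier ?P"
    unfolding carrier_product_group
    by (rule subsetI) (rule conjunct1[OF carrier_pro_completion_iff[THEN iffD1]])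
  have "subgroup (carrier (pro_completion \<C> G)) ?P"
  proof (rule group.subgroupI[OF gP])
    show "carrier (pro_completion \<C> G) \<subseteq> carrier ?P" by (rule subP)
    have "\<one>\<^bsub>?P\<^esub> \<in> carrier (pro_completion \<C> G)"
    proof (rule pro_completion_memI[OF G])
      show "\<one>\<^bsub>?P\<^esub> \<in> (\<Pi>\<^sub>E N\<in>?I. carrier (G Mod N))"
        using monoid.one_closed[OF group.is_monoid[OF gP]] by (simp only: carrier_product_group)
      fix N M assume "N \<in> ?I" "M \<in> ?I"
      then show "\<exists>g\<in>carrier G. \<one>\<^bsub>?P\<^esub> N = N #>\<^bsub>G\<^esub> g \<and> \<one>\<^bsub>?P\<^esub> M = M #>\<^bsub>G\<^esub> g"
        using coset_mult_one[OF subgroup.subset[OF co_normalsD(2)]]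
        by (intro bexI[of _ "\<one>\<^bsub>G\<^esub>"]) simp_all
    qed
    then show "carrier (pro_completion \<C> G) \<noteq> {}" by blast
  next
    fix x assume x: "x \<in> carrier (pro_completion \<C> G)"
    have xP: "x \<in> carrier ?P" using subP x by blast
    have xE: "x \<in> (\<Pi>\<^sub>E N\<in>?I. carrier (G Mod N))" using xP by simp
    show "inv\<^bsub>?P\<^esub> x \<in> carrier (pro_completion \<C> G)"
    proof (rule pro_completion_memI[OF G])
      show "inv\<^bsub>?P\<^esub> x \<in> (\<Pi>\<^sub>E N\<in>?I. carrier (G Mod N))"
        using group.inv_closed[OF gP xP] by (simp only: carrier_product_group)
      fix N M assume N: "N \<in> ?I" and M: "M \<in> ?I" and NM: "N \<subseteq> M"
      obtain g where g: "g \<in> carrier G" "x N = N #>\<^bsub>G\<^esub> g" using pro_completion_rep[OF x N] .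
      then have xM: "x M = M #>\<^bsub>G\<^esub> g" using pro_completion_compat[OF x N M NM] by simp
      have "(inv\<^bsub>?P\<^esub> x) A = A #>\<^bsub>G\<^esub> inv\<^bsub>G\<^esub> g" if A: "A \<in> ?I" "x A = A #>\<^bsub>G\<^esub> g" for A
      proof -
        have "(inv\<^bsub>?P\<^esub> x) A = inv\<^bsub>G Mod A\<^esub> (A #>\<^bsub>G\<^esub> g)"
          using inv_product_group[OF xE gq] A by simp
        also have "\<dots> = A #>\<^bsub>G\<^esub> inv\<^bsub>G\<^esub> g"
          using normal.inv_FactGroup[OF co_normalsD(1)[OF A(1)]]
            normal.rcos_inv[OF co_normalsD(1)[OF A(1)] g(1)] g(1)
          by (simp add: carrier_FactGroup)
        finally show ?thesis .
      qed
      then show "\<exists>h\<in>carrier G. (inv\<^bsub>?P\<^esub> x) N = N #>\<^bsub>G\<^esub> h \<and> (inv\<^bsub>?P\<^esub> x) M = M #>\<^bsub>G\<^esub> h"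
        using N M g xM by (intro bexI[of _ "inv\<^bsub>G\<^esub> g"]) auto
    qed
  next
    fix x y assume x: "x \<in> carrier (pro_completion \<C> G)" and y: "y \<in> carrier (pro_completion \<C> G)"
    have xP: "x \<in> carrier ?P" using subP x by blast
    have yP: "y \<in> carrier ?P" using subP y by blast
    show "x \<otimes>\<^bsub>?P\<^esub> y \<in> carrier (pro_completion \<C> G)"
    proof (rule pro_completion_memI[OF G])
      show "x \<otimes>\<^bsub>?P\<^esub> y \<in> (\<Pi>\<^sub>E N\<in>?I. carrier (G Mod N))"
        using monoid.m_closed[OF group.is_monoid[OF gP] xP yP] by (simp only: carrier_product_group)
      fix N M assume N: "N \<in> ?I" and M: "M \<in> ?I" and NM: "N \<subseteq> M"
      obtain g where g: "g \<in> carrier G" "x N = N #>\<^bsub>G\<^esub> g" using pro_completion_rep[OF x N] .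
      obtain h where h: "h \<in> carrier G" "y N = N #>\<^bsub>G\<^esub> h" using pro_completion_rep[OF y N] .
      have "x M = M #>\<^bsub>G\<^esub> g" "y M = M #>\<^bsub>G\<^esub> h"
        using pro_completion_compat[OF x N M NM g] pro_completion_compat[OF y N M NM h] .
      then show "\<exists>k\<in>carrier G. (x \<otimes>\<^bsub>?P\<^esub> y) N = N #>\<^bsub>G\<^esub> k \<and> (x \<otimes>\<^bsub>?P\<^esub> y) M = M #>\<^bsub>G\<^esub> k"
        using N M g h normal.rcos_sum[OF co_normalsD(1)[OF N] g(1) h(1)]
          normal.rcos_sum[OF co_normalsD(1)[OF M] g(1) h(1)]
        by (intro bexI[of _ "g \<otimes>\<^bsub>G\<^esub> h"]) simp_all
    qed
  qed
  then have "group (?P\<lparr>carrier := carrier (pro_completion \<C> G)\<rparr>)"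
    by (rule group.subgroup_imp_group[OF gP])
  moreover have "?P\<lparr>carrier := carrier (pro_completion \<C> G)\<rparr> = pro_completion \<C> G"
    by (simp add: pro_completion_def)
  ultimately show ?thesis by simp
qed

lemma pro_completion_mult:
  assumes "N \<in> co_normals \<C> G" "g \<in> carrier G" "h \<in> carrier G" "x N = N #>\<^bsub>G\<^esub> g" "y N = N #>\<^bsub>G\<^esub> h"
  shows "(x \<otimes>\<^bsub>pro_completion \<C> G\<^esub> y) N = N #>\<^bsub>G\<^esub> (g \<otimes>\<^bsub>G\<^esub> h)"
  using assms normal.rcos_sum[OF co_normalsD(1)[OF assms(1)]] by (simp add: pro_completion_def)

lemma pro_completion_emb_in_carrier:
  assumes G: "group G" and g: "g \<in> carrier G"
  shows "pro_completion_emb \<C> G g \<in> carrier (pro_completion \<C> G)"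
proof (rule pro_completion_memI[OF G])
  show "pro_completion_emb \<C> G g \<in> (\<Pi>\<^sub>E N\<in>co_normals \<C> G. carrier (G Mod N))"
    using g by (simp add: pro_completion_emb_def carrier_FactGroup)
  fix N M assume "N \<in> co_normals \<C> G" "M \<in> co_normals \<C> G"
  then show "\<exists>h\<in>carrier G. pro_completion_emb \<C> G g N = N #>\<^bsub>G\<^esub> h \<and>
      pro_completion_emb \<C> G g M = M #>\<^bsub>G\<^esub> h"
    using g by (intro bexI[of _ g]) (simp_all add: pro_completion_emb_def)
qed

text \<open>
  Every inverse system of nonempty subsets of the finite quotients \<open>G/N\<close>, given here by
  representatives in \<open>G\<close>, has a nonempty inverse limit.
\<close>

lemma pro_completion_limit:
  assumes C: "extension_closed_pseudovariety \<C>" and G: "group G"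
    and ne: "\<And>N. N \<in> co_normals \<C> G \<Longrightarrow> S N \<noteq> {}"
    and sub: "\<And>N. N \<in> co_normals \<C> G \<Longrightarrow> S N \<subseteq> carrier G"
    and mono: "\<And>N M. N \<in> co_normals \<C> G \<Longrightarrow> M \<in> co_normals \<C> G \<Longrightarrow> N \<subseteq> M \<Longrightarrow> S N \<subseteq> S M"
  shows "\<exists>x\<in>carrier (pro_completion \<C> G). \<forall>N\<in>co_normals \<C> G. \<exists>g\<in>S N. x N = N #>\<^bsub>G\<^esub> g"
proof -
  interpret group G by fact
  let ?I = "co_normals \<C> G"
  let ?X = "product_topology (\<lambda>N. discrete_topology (carrier (G Mod N))) ?I"
  \<comment> \<open>\<open>Q N g\<close> is the box of families that agree with the image of g at
    every M above N; it depends only on the coset Ng. So \<open>F N\<close> is a finite union of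
    closed boxes. Compactness is applied to the full product, and compatibility of the limit is read
    off from the boxes, so the completion need not be shown closed.\<close>
  define Q where "Q = (\<lambda>N g. \<Pi>\<^sub>E M\<in>?I. if N \<subseteq> M then {M #>\<^bsub>G\<^esub> g} else carrier (G Mod M))"
  define F where "F = (\<lambda>N. \<Union>(Q N ` S N))"
  have closed: "closedin ?X (F N)" if N: "N \<in> ?I" for N
    unfolding F_def
  proof (rule closedin_Union)
    have "Q N x = Q N y"
      if "x \<in> carrier G" "y \<in> carrier G" "N #>\<^bsub>G\<^esub> x = N #>\<^bsub>G\<^esub> y" for x y
      unfolding Q_def
      using r_coset_eq_mono[OF co_normalsD(2)[OF N] co_normalsD(2) _ that] by (intro PiE_cong) simp
    then have "finite (Q N ` carrier G)" by (rule finite_image_cosets[OF C G N])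
    then show "finite (Q N ` S N)" using sub[OF N] by (meson finite_subset image_mono)
    fix T assume "T \<in> Q N ` S N"
    then obtain g where "g \<in> carrier G" "T = Q N g" using sub[OF N] by blast
    then show "closedin ?X T"
      by (auto simp: Q_def closedin_product_topology carrier_FactGroup)
  qed
  \<comment> \<open>For finitely many indices, an element of S at their intersection belongs by
    monotonicity to S at each of them, and its image lies in every box concerned.\<close>
  have fip: "\<Inter>\<F> \<noteq> {}" if fin: "finite \<F>" "\<F> \<subseteq> F ` ?I" for \<F>
  proof (cases "\<F> = {}")
    case False
    obtain A where A: "A \<subseteq> ?I" "finite A" "\<F> = F ` A"
      using finite_subset_image[OF fin] by blast
    have N: "\<Inter>A \<in> ?I" by (rule co_normals_Inter[OF C G A(2) _ A(1)]) (use False A in auto)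
    obtain g where g: "g \<in> S (\<Inter>A)" using ne[OF N] by blast
    have gc: "g \<in> carrier G" using g sub[OF N] by blast
    have "pro_completion_emb \<C> G g \<in> F M" if M: "M \<in> A" for M
    proof -
      have "g \<in> S M" using mono[OF N, of M] M A(1) g by blast
      moreover have "pro_completion_emb \<C> G g \<in> Q M g"
        using gc by (auto simp: pro_completion_emb_def Q_def carrier_FactGroup)
      ultimately show ?thesis by (auto simp: F_def)
    qed
    then show ?thesis using A(3) by blast
  qed simp
  have cpt: "compact_space ?X"
    unfolding compact_space_product_topology compact_space_discrete_topology
    using in_class_finite[OF C co_normalsD(3)] by blast
  have "\<Inter>(F ` ?I) \<noteq> {}"
    by (rule mp[OF spec[OF cpt[unfolded compact_space_fip]]]) (simp add: closed fip)
  then obtain x where x: "\<And>N. N \<in> ?I \<Longrightarrow> x \<in> F N" by blast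
  have xS: "\<exists>g\<in>S N. x \<in> Q N g" if "N \<in> ?I" for N
    using x[OF that] by (auto simp: F_def)
  have Qv: "x M = M #>\<^bsub>G\<^esub> g" if "x \<in> Q N g" "M \<in> ?I" "N \<subseteq> M" for N M g
    using PiE_mem[OF that(1)[unfolded Q_def] that(2)] that(3) by simp
  have "x \<in> carrier (pro_completion \<C> G)"
  proof (rule pro_completion_memI[OF G])
    \<comment> \<open>Any index would do here; the carrier of G is one that is always
      available.\<close>
    have "x \<in> extensional ?I"
      using xS[OF carrier_in_co_normals[OF C G]] by (auto simp: Q_def PiE_def)
    moreover have "x N \<in> carrier (G Mod N)" if N: "N \<in> ?I" for N
      using xS[OF N] Qv[OF _ N] sub[OF N] by (auto simp: carrier_FactGroup)
    ultimately show "x \<in> (\<Pi>\<^sub>E N\<in>?I. carrier (G Mod N))" by (auto simp: PiE_def)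
    fix N M assume N: "N \<in> ?I" and M: "M \<in> ?I" "N \<subseteq> M"
    then show "\<exists>g\<in>carrier G. x N = N #>\<^bsub>G\<^esub> g \<and> x M = M #>\<^bsub>G\<^esub> g"
      using xS[OF N] Qv sub[OF N] by blast
  qed
  moreover have "\<exists>g\<in>S N. x N = N #>\<^bsub>G\<^esub> g" if "N \<in> ?I" for N
    using xS[OF that] Qv[OF _ that] by blast
  ultimately show ?thesis by blast
qed

section \<open>Closures in the completion\<close>

text \<open>A neighbourhood in the product restricts finitely many coordinates, and compatibility
  makes all of them depend on the coordinate at their intersection. So fixing a single coordinate
  gives a neighbourhood base, and closure can be tested in one quotient at a time.\<close>

lemma closure_of_pro_completion_emb:
  assumes C: "extension_closed_pseudovariety \<C>" and G: "group G" and X: "X \<subseteq> carrier G"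
  shows "pro_completion_topology \<C> G closure_of (pro_completion_emb \<C> G ` X) =
    {x \<in> carrier (pro_completion \<C> G). \<forall>N\<in>co_normals \<C> G. \<exists>g\<in>X. x N = N #>\<^bsub>G\<^esub> g}"
    (is "?T closure_of ?E = ?R")
proof -
  interpret group G by fact
  let ?I = "co_normals \<C> G" and ?P = "pro_completion \<C> G"
  let ?X = "product_topology (\<lambda>N. discrete_topology (carrier (G Mod N))) ?I"
  have PX: "carrier ?P \<subseteq> topspace ?X"
  proof
    fix x assume "x \<in> carrier ?P"
    then show "x \<in> topspace ?X" by (simp add: carrier_pro_completion_iff)
  qed
  then have top: "topspace ?T = carrier ?P"
    unfolding pro_completion_topology_def topspace_subtopology by (rule Int_absorb1)
  have basic: "openin ?T {y \<in> carrier ?P. y N = x N}" if x: "x \<in> carrier ?P" and N: "N \<in> ?I" for x N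
  proof -
    have xN: "x N \<in> carrier (G Mod N)" using x N PX by auto
    have "openin ?X {y \<in> topspace ?X. y N \<in> {x N}}"
      by (rule openin_continuous_map_preimage[OF continuous_map_product_projection[OF N]])
        (use xN in simp)
    then show ?thesis
      unfolding pro_completion_topology_def openin_subtopology using PX
      by (intro exI[of _ "{y \<in> topspace ?X. y N \<in> {x N}}"]) auto
  qed
  have nbhd: "\<exists>N\<in>?I. {y \<in> carrier ?P. y N = x N} \<subseteq> U" if x: "x \<in> U" and U: "openin ?T U" for x U
  proof -
    obtain V where V: "openin ?X V" "U = V \<inter> carrier ?P"
      using U by (auto simp: pro_completion_topology_def openin_subtopology)
    have xP: "x \<in> carrier ?P" using x V(2) by blast
    obtain W where W: "finite {i \<in> ?I. W i \<noteq> carrier (G Mod i)}" "x \<in> Pi\<^sub>E ?I W" "Pi\<^sub>E ?I W \<subseteq> V"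
      using V(1) x V(2) unfolding openin_product_topology_alt by auto
    \<comment> \<open>The carrier of G keeps the family nonempty when no coordinate is
      restricted.\<close>
    let ?A = "insert (carrier G) {i \<in> ?I. W i \<noteq> carrier (G Mod i)}"
    have A: "?A \<subseteq> ?I" using carrier_in_co_normals[OF C G] by auto
    have N: "\<Inter>?A \<in> ?I"
      by (rule co_normals_Inter[OF C G _ _ A]) (use W(1) in auto)
    have "y \<in> U" if y: "y \<in> carrier ?P" and eq: "y (\<Inter>?A) = x (\<Inter>?A)" for y
    proof -
      obtain g where g: "g \<in> carrier G" "x (\<Inter>?A) = (\<Inter>?A) #>\<^bsub>G\<^esub> g"
        using pro_completion_rep[OF xP N] .
      have "y M \<in> W M" if M: "M \<in> ?I" for M
      proof (cases "W M = carrier (G Mod M)")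
        case True
        then show ?thesis using y PX M by auto
      next
        case False
        then have "\<Inter>?A \<subseteq> M" using M by blast
        then have "y M = x M"
          using pro_completion_compat[OF xP N M _ g] pro_completion_compat[OF y N M _ g(1)] eq g(2)
          by simp
        then show ?thesis using W(2) M by auto
      qed
      then have "y \<in> Pi\<^sub>E ?I W" using y PX by (auto simp: PiE_iff)
      then show ?thesis using W(3) V(2) y by blast
    qed
    with N show ?thesis by blast
  qed
  have emb: "pro_completion_emb \<C> G g \<in> carrier ?P" if "g \<in> X" for g
    using pro_completion_emb_in_carrier[OF G] that X by blast
  have embN: "pro_completion_emb \<C> G g N = N #>\<^bsub>G\<^esub> g" if "N \<in> ?I" for g N
    using that by (simp add: pro_completion_emb_def)
  show ?thesis
  proof (intro subset_antisym subsetI)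
    fix x assume x: "x \<in> ?T closure_of ?E"
    then have xP: "x \<in> carrier ?P" using top by (auto simp: in_closure_of)
    have "\<exists>g\<in>X. x N = N #>\<^bsub>G\<^esub> g" if N: "N \<in> ?I" for N
    proof -
      have "x \<in> {y \<in> carrier ?P. y N = x N}" using xP by simp
      then obtain y where "y \<in> ?E" "y \<in> {y \<in> carrier ?P. y N = x N}"
        using conjunct2[OF x[unfolded in_closure_of], rule_format, OF conjI[OF _ basic[OF xP N]]]
        by blast
      then show ?thesis using embN[OF N] by auto
    qed
    with xP show "x \<in> ?R" by simp
  next
    fix x assume x: "x \<in> ?R"
    have "\<exists>y. y \<in> ?E \<and> y \<in> U" if U: "x \<in> U \<and> openin ?T U" for U
    proof -
      obtain N where N: "N \<in> ?I" "{y \<in> carrier ?P. y N = x N} \<subseteq> U"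
        using nbhd[OF conjunct1[OF U] conjunct2[OF U]] by blast
      obtain g where g: "g \<in> X" "x N = N #>\<^bsub>G\<^esub> g" using x N(1) by blast
      have "pro_completion_emb \<C> G g \<in> U"
        by (rule subsetD[OF N(2)]) (simp add: emb[OF g(1)] embN[OF N(1)] g(2))
      then show ?thesis using g(1) by blast
    qed
    then show "x \<in> ?T closure_of ?E" using x top by (simp add: in_closure_of)
  qed
qed

section \<open>Conjugacy and commutation in the completion\<close>

text \<open>The equation says that x conjugates the image of g to the image of y, written without
  inverses. For y = g it says that x centralizes the image of g, so this lemma and its converse
  serve both statements of the theorem.\<close>

lemma pro_completion_intertwineD:
  assumes g: "g \<in> carrier G" and y: "y \<in> carrier G"
    and eq: "x \<otimes>\<^bsub>pro_completion \<C> G\<^esub> pro_completion_emb \<C> G g =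
      pro_completion_emb \<C> G y \<otimes>\<^bsub>pro_completion \<C> G\<^esub> x"
    and N: "N \<in> co_normals \<C> G" and h: "h \<in> carrier G" "x N = N #>\<^bsub>G\<^esub> h"
  shows "N #>\<^bsub>G\<^esub> (h \<otimes>\<^bsub>G\<^esub> g) = N #>\<^bsub>G\<^esub> (y \<otimes>\<^bsub>G\<^esub> h)"
proof -
  have e: "pro_completion_emb \<C> G a N = N #>\<^bsub>G\<^esub> a" for a
    using N by (simp add: pro_completion_emb_def)
  show ?thesis
    using pro_completion_mult[where x = x and y = "pro_completion_emb \<C> G g", OF N h(1) g h(2) e]
      pro_completion_mult[where x = "pro_completion_emb \<C> G y" and y = x, OF N y h(1) e h(2)] eq
    by simp
qed

lemma pro_completion_intertwineI:
  assumes G: "group G" and x: "x \<in> carrier (pro_completion \<C> G)"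
    and g: "g \<in> carrier G" and y: "y \<in> carrier G"
    and ex: "\<And>N. N \<in> co_normals \<C> G \<Longrightarrow> \<exists>h\<in>carrier G. x N = N #>\<^bsub>G\<^esub> h \<and>
      N #>\<^bsub>G\<^esub> (h \<otimes>\<^bsub>G\<^esub> g) = N #>\<^bsub>G\<^esub> (y \<otimes>\<^bsub>G\<^esub> h)"
  shows "x \<otimes>\<^bsub>pro_completion \<C> G\<^esub> pro_completion_emb \<C> G g =
      pro_completion_emb \<C> G y \<otimes>\<^bsub>pro_completion \<C> G\<^esub> x"
proof -
  interpret P: group "pro_completion \<C> G" by (rule pro_completion_group[OF G])
  show ?thesis
  proof (rule pro_completion_eqI)
    fix N assume N: "N \<in> co_normals \<C> G"
    have e: "pro_completion_emb \<C> G a N = N #>\<^bsub>G\<^esub> a" for a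
      using N by (simp add: pro_completion_emb_def)
    obtain h where h: "h \<in> carrier G" "x N = N #>\<^bsub>G\<^esub> h"
      "N #>\<^bsub>G\<^esub> (h \<otimes>\<^bsub>G\<^esub> g) = N #>\<^bsub>G\<^esub> (y \<otimes>\<^bsub>G\<^esub> h)"
      using ex[OF N] by blast
    show "(x \<otimes>\<^bsub>pro_completion \<C> G\<^esub> pro_completion_emb \<C> G g) N =
        (pro_completion_emb \<C> G y \<otimes>\<^bsub>pro_completion \<C> G\<^esub> x) N"
      using pro_completion_mult[where x = x and y = "pro_completion_emb \<C> G g", OF N h(1) g h(2) e]
        pro_completion_mult[where x = "pro_completion_emb \<C> G y" and y = x, OF N y h(1) e h(2)] h(3)
      by simp
  qed (use x g y pro_completion_emb_in_carrier[OF G] in simp_all)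
qed

text \<open>A conjugator in the completion gives one in each quotient through its coordinates.
  Conversely, the sets of conjugators modulo N shrink with N, and a point of their inverse limit
  conjugates in the completion.\<close>

lemma pro_completion_emb_conjugate_iff:
  assumes C: "extension_closed_pseudovariety \<C>" and G: "group G"
    and g: "g \<in> carrier G" and y: "y \<in> carrier G"
  shows "pro_completion_emb \<C> G y \<in>
      conjugates (pro_completion \<C> G) (pro_completion_emb \<C> G g) (carrier (pro_completion \<C> G)) \<longleftrightarrow>
    (\<forall>N\<in>co_normals \<C> G. \<exists>h\<in>carrier G.
       N #>\<^bsub>G\<^esub> (h \<otimes>\<^bsub>G\<^esub> g \<otimes>\<^bsub>G\<^esub> inv\<^bsub>G\<^esub> h) = N #>\<^bsub>G\<^esub> y)" (is "?L \<longleftrightarrow> ?R")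
proof -
  let ?P = "pro_completion \<C> G" and ?e = "pro_completion_emb \<C> G"
  interpret group G by fact
  interpret P: group ?P by (rule pro_completion_group[OF G])
  have eP: "?e g \<in> carrier ?P" "?e y \<in> carrier ?P"
    using pro_completion_emb_in_carrier[OF G] g y by auto
  have coset: "N #>\<^bsub>G\<^esub> (h \<otimes>\<^bsub>G\<^esub> g \<otimes>\<^bsub>G\<^esub> inv\<^bsub>G\<^esub> h) = N #>\<^bsub>G\<^esub> y \<longleftrightarrow>
      N #>\<^bsub>G\<^esub> (h \<otimes>\<^bsub>G\<^esub> g) = N #>\<^bsub>G\<^esub> (y \<otimes>\<^bsub>G\<^esub> h)" (is "?A \<longleftrightarrow> ?B")
    if N: "N \<in> co_normals \<C> G" and h: "h \<in> carrier G" for N h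
  proof
    assume A: ?A
    have "N #>\<^bsub>G\<^esub> (\<one>\<^bsub>G\<^esub> \<otimes>\<^bsub>G\<^esub> (h \<otimes>\<^bsub>G\<^esub> g \<otimes>\<^bsub>G\<^esub> inv\<^bsub>G\<^esub> h) \<otimes>\<^bsub>G\<^esub> h) =
        N #>\<^bsub>G\<^esub> (\<one>\<^bsub>G\<^esub> \<otimes>\<^bsub>G\<^esub> y \<otimes>\<^bsub>G\<^esub> h)"
      by (rule normal.r_coset_eq_mult[OF co_normalsD(1)[OF N] _ _ _ _ A]) (use h g y in auto)
    then show ?B using h g y by (simp add: m_assoc)
  next
    assume B: ?B
    have "N #>\<^bsub>G\<^esub> (\<one>\<^bsub>G\<^esub> \<otimes>\<^bsub>G\<^esub> (h \<otimes>\<^bsub>G\<^esub> g) \<otimes>\<^bsub>G\<^esub> inv\<^bsub>G\<^esub> h) =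
        N #>\<^bsub>G\<^esub> (\<one>\<^bsub>G\<^esub> \<otimes>\<^bsub>G\<^esub> (y \<otimes>\<^bsub>G\<^esub> h) \<otimes>\<^bsub>G\<^esub> inv\<^bsub>G\<^esub> h)"
      by (rule normal.r_coset_eq_mult[OF co_normalsD(1)[OF N] _ _ _ _ B]) (use h g y in auto)
    then show ?A using h g y by (simp add: m_assoc)
  qed
  show ?thesis
  proof
    assume ?L
    then obtain x where x: "x \<in> carrier ?P" and eq: "?e y = x \<otimes>\<^bsub>?P\<^esub> ?e g \<otimes>\<^bsub>?P\<^esub> inv\<^bsub>?P\<^esub> x"
      by (auto simp: conjugates_def)
    have xg: "x \<otimes>\<^bsub>?P\<^esub> ?e g = ?e y \<otimes>\<^bsub>?P\<^esub> x"
      unfolding eq using x eP(1) by (simp add: P.m_assoc)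
    show ?R
    proof
      fix N assume N: "N \<in> co_normals \<C> G"
      obtain h where h: "h \<in> carrier G" "x N = N #>\<^bsub>G\<^esub> h" using pro_completion_rep[OF x N] .
      show "\<exists>h\<in>carrier G. N #>\<^bsub>G\<^esub> (h \<otimes>\<^bsub>G\<^esub> g \<otimes>\<^bsub>G\<^esub> inv\<^bsub>G\<^esub> h) = N #>\<^bsub>G\<^esub> y"
        using pro_completion_intertwineD[OF g y xg N h] coset[OF N h(1)] h(1) by blast
    qed
  next
    assume R: ?R
    define S where "S = (\<lambda>N. {h \<in> carrier G. N #>\<^bsub>G\<^esub> (h \<otimes>\<^bsub>G\<^esub> g \<otimes>\<^bsub>G\<^esub> inv\<^bsub>G\<^esub> h) = N #>\<^bsub>G\<^esub> y})"
    have mono: "S N \<subseteq> S M" if N: "N \<in> co_normals \<C> G" and M: "M \<in> co_normals \<C> G" "N \<subseteq> M" for N M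
    proof
      fix h assume "h \<in> S N"
      then have h: "h \<in> carrier G" "N #>\<^bsub>G\<^esub> (h \<otimes>\<^bsub>G\<^esub> g \<otimes>\<^bsub>G\<^esub> inv\<^bsub>G\<^esub> h) = N #>\<^bsub>G\<^esub> y"
        by (auto simp: S_def)
      have "M #>\<^bsub>G\<^esub> (h \<otimes>\<^bsub>G\<^esub> g \<otimes>\<^bsub>G\<^esub> inv\<^bsub>G\<^esub> h) = M #>\<^bsub>G\<^esub> y"
        by (rule r_coset_eq_mono[OF co_normalsD(2)[OF N] co_normalsD(2)[OF M(1)] M(2) _ y h(2)])
          (use h(1) g in simp)
      with h(1) show "h \<in> S M" by (simp add: S_def)
    qed
    have ne: "S N \<noteq> {}" if "N \<in> co_normals \<C> G" for N
      using bspec[OF R that] by (auto simp: S_def)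
    have sub: "S N \<subseteq> carrier G" for N by (auto simp: S_def)
    obtain x where x: "x \<in> carrier ?P"
      "\<And>N. N \<in> co_normals \<C> G \<Longrightarrow> \<exists>h\<in>S N. x N = N #>\<^bsub>G\<^esub> h"
      using pro_completion_limit[OF C G, of S, OF ne sub mono] by blast
    have "x \<otimes>\<^bsub>?P\<^esub> ?e g = ?e y \<otimes>\<^bsub>?P\<^esub> x"
    proof (rule pro_completion_intertwineI[OF G x(1) g y])
      fix N assume N: "N \<in> co_normals \<C> G"
      obtain h where "h \<in> S N" "x N = N #>\<^bsub>G\<^esub> h" using x(2)[OF N] by blast
      then show "\<exists>h\<in>carrier G. x N = N #>\<^bsub>G\<^esub> h \<and> N #>\<^bsub>G\<^esub> (h \<otimes>\<^bsub>G\<^esub> g) = N #>\<^bsub>G\<^esub> (y \<otimes>\<^bsub>G\<^esub> h)"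
        using coset[OF N] by (auto simp: S_def)
    qed
    then have "x \<otimes>\<^bsub>?P\<^esub> ?e g \<otimes>\<^bsub>?P\<^esub> inv\<^bsub>?P\<^esub> x = ?e y"
      using x(1) eP by (simp add: P.m_assoc)
    then show ?L
      unfolding conjugates_def by (intro CollectI exI[of _ x] conjI x(1)) (rule sym)
  qed
qed

text \<open>If a and b have the same image, then a b^-1 cannot be told apart from the identity in
  any quotient, while closedness of the trivial subgroup separates it from every other
  element.\<close>

lemma pro_completion_emb_inj_on:
  assumes C: "extension_closed_pseudovariety \<C>" and G: "group G" and res: "residually \<C> G"
  shows "inj_on (pro_completion_emb \<C> G) (carrier G)"
proof (rule inj_onI)
  interpret group G by fact
  fix a b assume a: "a \<in> carrier G" and b: "b \<in> carrier G"
    and eq: "pro_completion_emb \<C> G a = pro_completion_emb \<C> G b"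
  have coset: "N #>\<^bsub>G\<^esub> \<one>\<^bsub>G\<^esub> = N #>\<^bsub>G\<^esub> (a \<otimes>\<^bsub>G\<^esub> inv\<^bsub>G\<^esub> b)" if N: "N \<in> co_normals \<C> G" for N
  proof -
    have ab: "N #>\<^bsub>G\<^esub> b = N #>\<^bsub>G\<^esub> a"
      using fun_cong[OF eq, of N] N by (simp add: pro_completion_emb_def)
    have "N #>\<^bsub>G\<^esub> (\<one>\<^bsub>G\<^esub> \<otimes>\<^bsub>G\<^esub> b \<otimes>\<^bsub>G\<^esub> inv\<^bsub>G\<^esub> b) = N #>\<^bsub>G\<^esub> (\<one>\<^bsub>G\<^esub> \<otimes>\<^bsub>G\<^esub> a \<otimes>\<^bsub>G\<^esub> inv\<^bsub>G\<^esub> b)"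
      by (rule normal.r_coset_eq_mult[OF co_normalsD(1)[OF N] _ _ _ _ ab]) (use a b in auto)
    then show ?thesis using a b by simp
  qed
  have "a \<otimes>\<^bsub>G\<^esub> inv\<^bsub>G\<^esub> b = \<one>\<^bsub>G\<^esub>"
  proof (rule ccontr)
    assume "a \<otimes>\<^bsub>G\<^esub> inv\<^bsub>G\<^esub> b \<noteq> \<one>\<^bsub>G\<^esub>"
    then have "a \<otimes>\<^bsub>G\<^esub> inv\<^bsub>G\<^esub> b \<in> carrier G - {\<one>\<^bsub>G\<^esub>}" using a b by simp
    then obtain N where "N \<in> co_normals \<C> G" "N #>\<^bsub>G\<^esub> \<one>\<^bsub>G\<^esub> \<noteq> N #>\<^bsub>G\<^esub> (a \<otimes>\<^bsub>G\<^esub> inv\<^bsub>G\<^esub> b)"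
      using conjunct2[OF res[unfolded residually_def closedin_pro_topology_iff[OF C G]]] by blast
    then show False using coset by blast
  qed
  then have "a \<otimes>\<^bsub>G\<^esub> inv\<^bsub>G\<^esub> b \<otimes>\<^bsub>G\<^esub> b = \<one>\<^bsub>G\<^esub> \<otimes>\<^bsub>G\<^esub> b" by (rule arg_cong)
  then show "a = b" using a b by (simp add: m_assoc)
qed

text \<open>Images of conjugates of g are conjugate in the completion for any G, so only one
  inclusion carries information. Injectivity of the embedding pulls that inclusion back to
  G.\<close>

lemma conjugacy_separable_iff_pro_completion:
  assumes C: "extension_closed_pseudovariety \<C>" and G: "group G" and res: "residually \<C> G"
  shows "conjugacy_separable \<C> G \<longleftrightarrow>
    (\<forall>g\<in>carrier G.
       conjugates (pro_completion \<C> G) (pro_completion_emb \<C> G g) (carrier (pro_completion \<C> G))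
           \<inter> pro_completion_emb \<C> G ` carrier G
         = pro_completion_emb \<C> G ` conjugates G g (carrier G))"
proof -
  let ?P = "pro_completion \<C> G" and ?e = "pro_completion_emb \<C> G"
  interpret group G by fact
  have "(\<forall>y\<in>carrier G. (\<forall>N\<in>co_normals \<C> G. \<exists>h\<in>carrier G.
          N #>\<^bsub>G\<^esub> (h \<otimes>\<^bsub>G\<^esub> g \<otimes>\<^bsub>G\<^esub> inv\<^bsub>G\<^esub> h) = N #>\<^bsub>G\<^esub> y) \<longrightarrow> y \<in> conjugates G g (carrier G)) \<longleftrightarrow>
      conjugates ?P (?e g) (carrier ?P) \<inter> ?e ` carrier G = ?e ` conjugates G g (carrier G)"
    if g: "g \<in> carrier G" for g
  proof -
    have sub: "conjugates G g (carrier G) \<subseteq> carrier G"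
      using g by (auto simp: conjugates_def)
    have "?e y \<in> conjugates ?P (?e g) (carrier ?P)" if y: "y \<in> conjugates G g (carrier G)" for y
      unfolding pro_completion_emb_conjugate_iff[OF C G g subsetD[OF sub y]]
      using y by (auto simp: conjugates_def)
    moreover have "?e y \<in> ?e ` conjugates G g (carrier G) \<longleftrightarrow> y \<in> conjugates G g (carrier G)"
      if "y \<in> carrier G" for y
      by (rule inj_on_image_mem_iff[OF pro_completion_emb_inj_on[OF C G res] that sub])
    ultimately have "conjugates ?P (?e g) (carrier ?P) \<inter> ?e ` carrier G =
          ?e ` conjugates G g (carrier G) \<longleftrightarrow>
        (\<forall>y\<in>carrier G. ?e y \<in> conjugates ?P (?e g) (carrier ?P) \<longrightarrow> y \<in> conjugates G g (carrier G))"
      using sub by blast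
    then show ?thesis using pro_completion_emb_conjugate_iff[OF C G g] by simp
  qed
  then show ?thesis unfolding conjugacy_separable_iff[OF C G] by simp
qed

text \<open>The closure Z always lies in the centralizer, because commuting with the image of g is
  tested coordinatewise. The condition is equivalent to the reverse inclusion: a failure at K is
  collected by compactness into one element that centralizes g but whose coordinate at K does not
  come from the centralizer in G.\<close>

lemma centralizer_condition_iff_pro_completion:
  assumes C: "extension_closed_pseudovariety \<C>" and G: "group G" and g: "g \<in> carrier G"
  shows "centralizer_condition \<C> G g \<longleftrightarrow>
    pro_completion_topology \<C> G closure_of (pro_completion_emb \<C> G ` centralizer G g)
      = centralizer (pro_completion \<C> G) (pro_completion_emb \<C> G g)"
proof -
  let ?P = "pro_completion \<C> G" and ?e = "pro_completion_emb \<C> G" and ?I = "co_normals \<C> G"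
  let ?C = "centralizer G g"
  interpret group G by fact
  have CG: "?C \<subseteq> carrier G" by (auto simp: centralizer_def)
  define Z where "Z = {x \<in> carrier ?P. \<forall>N\<in>?I. \<exists>c\<in>?C. x N = N #>\<^bsub>G\<^esub> c}"
  have Z: "pro_completion_topology \<C> G closure_of (?e ` ?C) = Z"
    unfolding Z_def by (rule closure_of_pro_completion_emb[OF C G CG])
  have sub: "Z \<subseteq> centralizer ?P (?e g)"
  proof
    fix x assume x: "x \<in> Z"
    then have xP: "x \<in> carrier ?P" by (simp add: Z_def)
    have "x \<otimes>\<^bsub>?P\<^esub> ?e g = ?e g \<otimes>\<^bsub>?P\<^esub> x"
    proof (rule pro_completion_intertwineI[OF G xP g g])
      fix N assume "N \<in> ?I"
      then obtain c where "c \<in> ?C" "x N = N #>\<^bsub>G\<^esub> c" using x unfolding Z_def by blast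
      then show "\<exists>h\<in>carrier G. x N = N #>\<^bsub>G\<^esub> h \<and> N #>\<^bsub>G\<^esub> (h \<otimes>\<^bsub>G\<^esub> g) = N #>\<^bsub>G\<^esub> (g \<otimes>\<^bsub>G\<^esub> h)"
        by (intro bexI[of _ c]) (simp_all add: centralizer_def)
    qed
    with xP show "x \<in> centralizer ?P (?e g)" by (simp add: centralizer_def)
  qed
  have "centralizer_condition \<C> G g \<longleftrightarrow> centralizer ?P (?e g) \<subseteq> Z"
  proof
    assume cc: "centralizer_condition \<C> G g"
    show "centralizer ?P (?e g) \<subseteq> Z"
    proof
      fix x assume "x \<in> centralizer ?P (?e g)"
      then have x: "x \<in> carrier ?P" "x \<otimes>\<^bsub>?P\<^esub> ?e g = ?e g \<otimes>\<^bsub>?P\<^esub> x"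
        by (simp_all add: centralizer_def)
      have "\<exists>c\<in>?C. x K = K #>\<^bsub>G\<^esub> c" if K: "K \<in> ?I" for K
      proof -
        obtain L where L: "L \<in> ?I" "L \<subseteq> K"
          "\<And>h. h \<in> carrier G \<Longrightarrow> L #>\<^bsub>G\<^esub> (h \<otimes>\<^bsub>G\<^esub> g) = L #>\<^bsub>G\<^esub> (g \<otimes>\<^bsub>G\<^esub> h) \<Longrightarrow>
             \<exists>c\<in>?C. K #>\<^bsub>G\<^esub> h = K #>\<^bsub>G\<^esub> c"
          using bspec[OF cc[unfolded centralizer_condition_def] K] by blast
        obtain h where h: "h \<in> carrier G" "x L = L #>\<^bsub>G\<^esub> h" using pro_completion_rep[OF x(1) L(1)] .
        have "x K = K #>\<^bsub>G\<^esub> h" by (rule pro_completion_compat[OF x(1) L(1) K L(2) h])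
        then show ?thesis
          using L(3)[OF h(1) pro_completion_intertwineD[OF g g x(2) L(1) h]] by simp
      qed
      with x(1) show "x \<in> Z" by (simp add: Z_def)
    qed
  next
    assume sub': "centralizer ?P (?e g) \<subseteq> Z"
    show "centralizer_condition \<C> G g"
      unfolding centralizer_condition_def
    proof (intro ballI, rule ccontr)
      fix K assume K: "K \<in> ?I" and "\<not> (\<exists>L\<in>?I. L \<subseteq> K \<and>
        (\<forall>h\<in>carrier G. L #>\<^bsub>G\<^esub> (h \<otimes>\<^bsub>G\<^esub> g) = L #>\<^bsub>G\<^esub> (g \<otimes>\<^bsub>G\<^esub> h) \<longrightarrow>
          (\<exists>c\<in>?C. K #>\<^bsub>G\<^esub> h = K #>\<^bsub>G\<^esub> c)))"
      then have neg: "\<exists>h\<in>carrier G. L #>\<^bsub>G\<^esub> (h \<otimes>\<^bsub>G\<^esub> g) = L #>\<^bsub>G\<^esub> (g \<otimes>\<^bsub>G\<^esub> h) \<and>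
            (\<forall>c\<in>?C. K #>\<^bsub>G\<^esub> h \<noteq> K #>\<^bsub>G\<^esub> c)" if "L \<in> ?I" "L \<subseteq> K" for L
        using that by simp
      \<comment> \<open>Commutation is required modulo the varying N, but avoidance of the
        centralizer modulo the fixed K. The second requirement does not depend on N, which makes S
        monotone.\<close>
      define S where "S = (\<lambda>N. {h \<in> carrier G. N #>\<^bsub>G\<^esub> (h \<otimes>\<^bsub>G\<^esub> g) = N #>\<^bsub>G\<^esub> (g \<otimes>\<^bsub>G\<^esub> h) \<and>
          (\<forall>c\<in>?C. K #>\<^bsub>G\<^esub> h \<noteq> K #>\<^bsub>G\<^esub> c)})"
      have mono: "S N \<subseteq> S M" if N: "N \<in> ?I" and M: "M \<in> ?I" "N \<subseteq> M" for N M
      proof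
        fix h assume h: "h \<in> S N"
        then have hc: "h \<in> carrier G" and eq: "N #>\<^bsub>G\<^esub> (h \<otimes>\<^bsub>G\<^esub> g) = N #>\<^bsub>G\<^esub> (g \<otimes>\<^bsub>G\<^esub> h)"
          by (simp_all add: S_def)
        have "M #>\<^bsub>G\<^esub> (h \<otimes>\<^bsub>G\<^esub> g) = M #>\<^bsub>G\<^esub> (g \<otimes>\<^bsub>G\<^esub> h)"
          by (rule r_coset_eq_mono[OF co_normalsD(2)[OF N] co_normalsD(2)[OF M(1)] M(2) _ _ eq])
            (use hc g in simp_all)
        with h show "h \<in> S M" by (simp add: S_def)
      qed
      \<comment> \<open>The negated condition gives witnesses only below K, so an arbitrary N is
        first intersected with K.\<close>
      have ne: "S N \<noteq> {}" if N: "N \<in> ?I" for N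
      proof -
        have NK: "N \<inter> K \<in> ?I" by (rule co_normals_Int[OF C G N K])
        have "S (N \<inter> K) \<noteq> {}" using neg[OF NK] by (auto simp: S_def)
        then show ?thesis using mono[OF NK N] by blast
      qed
      have sub_G: "S N \<subseteq> carrier G" for N by (auto simp: S_def)
      obtain x where x: "x \<in> carrier ?P"
        "\<And>N. N \<in> ?I \<Longrightarrow> \<exists>h\<in>S N. x N = N #>\<^bsub>G\<^esub> h"
        using pro_completion_limit[OF C G, of S, OF ne sub_G mono] by blast
      have "x \<otimes>\<^bsub>?P\<^esub> ?e g = ?e g \<otimes>\<^bsub>?P\<^esub> x"
      proof (rule pro_completion_intertwineI[OF G x(1) g g])
        fix N assume "N \<in> ?I"
        then obtain h where "h \<in> S N" "x N = N #>\<^bsub>G\<^esub> h" using x(2) by blast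
        then show "\<exists>h\<in>carrier G. x N = N #>\<^bsub>G\<^esub> h \<and> N #>\<^bsub>G\<^esub> (h \<otimes>\<^bsub>G\<^esub> g) = N #>\<^bsub>G\<^esub> (g \<otimes>\<^bsub>G\<^esub> h)"
          by (intro bexI[of _ h]) (simp_all add: S_def)
      qed
      then have "x \<in> Z" using sub' x(1) by (auto simp: centralizer_def)
      then obtain c where c: "c \<in> ?C" "x K = K #>\<^bsub>G\<^esub> c" using K unfolding Z_def by blast
      obtain h where "h \<in> S K" "x K = K #>\<^bsub>G\<^esub> h" using x(2)[OF K] by blast
      with c show False by (auto simp: S_def)
    qed
  qed
  with sub show ?thesis unfolding Z by blast
qed

theorem corollaryA3:
  fixes \<C> :: "nat monoid set" and G :: "('a, 'b) monoid_scheme"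
  assumes "extension_closed_pseudovariety \<C>"
    and "group G"
    and "residually \<C> G"
  shows "hereditarily_conjugacy_separable \<C> G \<longleftrightarrow>
    (\<forall>g\<in>carrier G.
       conjugates (pro_completion \<C> G) (pro_completion_emb \<C> G g) (carrier (pro_completion \<C> G))
           \<inter> pro_completion_emb \<C> G ` carrier G
         = pro_completion_emb \<C> G ` conjugates G g (carrier G) \<and>
       pro_completion_topology \<C> G closure_of (pro_completion_emb \<C> G ` centralizer G g)
         = centralizer (pro_completion \<C> G) (pro_completion_emb \<C> G g))"
  unfolding hereditarily_conjugacy_separable_iff[OF assms(1,2)]
    conjugacy_separable_iff_pro_completion[OF assms]
  by (simp add: centralizer_condition_iff_pro_completion[OF assms(1,2)] ball_conj_distrib)

end
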